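(* Let $(M,g)$ be a compact oriented surface with spin structure $S$. Suppose that $\psi_1,\dots,\psi_m$ are eigenspinors on $M$, $\psi_j=(\psi_{j+},\psi_{j-})$, with $\mathcal{D}_g\psi_j=\lambda\psi_j$ for all $j$, $\lambda\ne0$, and $$\sum_{j=1}^mQ_{\psi_j}=\tfrac12\lambda g.$$ Then the map $\Psi\colon M\to\mathbb{CP}^{2m-1}$ given in homogeneous coordinates by $[\psi_{1+}:\bar\psi_{1-}:\dots:\psi_{m+}:\bar\psi_{m-}]$ is a branched minimal immersion.
   Context: The orientation and $g$ give $M$ a complex structure with canonical bundle $K=(T^{(1,0)}M)^*$. A spin structure is a holomorphic line bundle $S$ with a holomorphic isomorphism $S\otimes S\cong K$; the spinor bundle is $\Sigma M=S\oplus\bar S$. With $g=\mathrm{Re}(h)$, $h$ Hermitian, the metric on $S$ is $|s|_g^2=|s\otimes s|_h$; if $z=x+iy$ is a local holomorphic coordinate and $s_0$ a local section with $s_0\otimes s_0=dz$, then $g=|s_0|_g^{-4}(dx^2+dy^2)$. $\mathcal{D}_g(\psi_+,\psi_-)=2(\partial_g\psi_-,-\bar\partial_g\psi_+)$ with, locally, $\bar\partial_g(fs_0)=|s_0|_g^2(\partial_{\bar z}f)\bar s_0$, $\partial_g(f\bar s_0)=|s_0|_g^2(\partial_zf)s_0$. Clifford multiplication is the $\mathbb{C}$-bilinear map $T_{\mathbb{C}}M\otimes\Sigma M\to\Sigma M$, $X\otimes\psi\mapsto X\cdot\psi$, given locally by $$\partial_{\bar z}\cdot(f_+s_0,f_-\bar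 s_0)=|s_0|^{-2}(f_-s_0,0),\qquad\partial_z\cdot(f_+s_0,f_-\bar s_0)=|s_0|^{-2}(0,-f_+\bar s_0).$$ The Clifford connection is $\nabla^{Cl}_X(\psi_+,\psi_-)=(\nabla^{Ch}_X\psi_+,\overline{\nabla^{Ch}_{\bar X}\bar\psi_-})$, where $\nabla^{Ch}$ is the Chern connection on $S$. One has $\mathcal{D}_g=e_1\cdot\nabla^{Cl}_{e_1}+e_2\cdot\nabla^{Cl}_{e_2}$ for a local orthonormal frame. The energy-momentum tensor of $\psi$ is the symmetric bilinear form $$Q_\psi(X,Y)=\tfrac12\mathrm{Re}\big(\langle X\cdot\nabla^{Cl}_Y\psi,\psi\rangle+\langle Y\cdot\nabla^{Cl}_X\psi,\psi\rangle\big).$$ $\psi_{j+}$ and $\bar\psi_{j-}$ are sections of the same line bundle $S$, so the homogeneous coordinates make sense. $\mathbb{CP}^{2m-1}$ carries (a multiple of) the Fubini–Study metric. *)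

theory Defs
  imports "HOL-Complex_Analysis.Complex_Analysis"
begin

section \<open>Calculus in coordinates\<close>

fun Ck_on :: "nat \<Rightarrow> ('a::real_normed_vector \<Rightarrow> 'b::real_normed_vector) \<Rightarrow> 'a set \<Rightarrow> bool" where
  "Ck_on 0 f S \<longleftrightarrow> continuous_on S f"
| "Ck_on (Suc k) f S \<longleftrightarrow> (\<forall>x\<in>S. f differentiable (at x)) \<and>
     (\<forall>v. Ck_on k (\<lambda>x. frechet_derivative f (at x) v) S)"

text \<open>Only used for open sets \<open>S\<close>.\<close>

definition smooth_on :: "('a::real_normed_vector \<Rightarrow> 'b::real_normed_vector) \<Rightarrow> 'a set \<Rightarrow> bool" where
  "smooth_on f S \<longleftrightarrow> (\<forall>k. Ck_on k f S)"

definition d_z :: "(complex \<Rightarrow> complex) \<Rightarrow> complex \<Rightarrow> complex" where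
  "d_z f w = (frechet_derivative f (at w) 1 - \<i> * frechet_derivative f (at w) \<i>) / 2"

definition d_zbar :: "(complex \<Rightarrow> complex) \<Rightarrow> complex \<Rightarrow> complex" where
  "d_zbar f w = (frechet_derivative f (at w) 1 + \<i> * frechet_derivative f (at w) \<i>) / 2"

section \<open>Oriented Riemannian surfaces with spin structure\<close>

text \<open>
  The complex structure is given by a family of charts \<open>z\<^sub>i = coord M i\<close> on \<open>cdom M i\<close>
  (\<open>i \<in> idx M\<close>); these are the oriented isothermal charts of the metric, which reads
  \<open>g = dens M i |dz\<^sub>i|\<^sup>2\<close>.
  The holomorphic line bundle \<open>S\<close> is given by holomorphic frames \<open>e\<^sub>i\<close> over \<open>cdom M i\<close> and its
  cocycle, \<open>e\<^sub>j = (cocycle M i j) e\<^sub>i\<close>; the isomorphism \<open>S \<otimes> S \<cong> K\<close> is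
  \<open>e\<^sub>i \<otimes> e\<^sub>i \<mapsto> (quad M i) dz\<^sub>i\<close>.
\<close>

record ('a, 'i) surface =
  idx :: "'i set"
  cdom :: "'i \<Rightarrow> 'a set"
  coord :: "'i \<Rightarrow> 'a \<Rightarrow> complex"
  dens :: "'i \<Rightarrow> 'a \<Rightarrow> real"

record ('a, 'i) spin_surface = "('a, 'i) surface" +
  cocycle :: "'i \<Rightarrow> 'i \<Rightarrow> 'a \<Rightarrow> complex"
  quad :: "'i \<Rightarrow> 'a \<Rightarrow> complex"

definition in_chart :: "('a, 'i, 'm) surface_scheme \<Rightarrow> 'i \<Rightarrow> ('a \<Rightarrow> 'b) \<Rightarrow> complex \<Rightarrow> 'b" where
  "in_chart M i F = F \<circ> inv_into (cdom M i) (coord M i)"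

text \<open>\<open>jac M i j\<close> is \<open>dz\<^sub>j / dz\<^sub>i\<close>, the cocycle of the canonical bundle \<open>K\<close>.\<close>

definition jac :: "('a, 'i, 'm) surface_scheme \<Rightarrow> 'i \<Rightarrow> 'i \<Rightarrow> 'a \<Rightarrow> complex" where
  "jac M i j p = deriv (in_chart M i (coord M j)) (coord M i p)"

definition riemann_surface :: "('a::t2_space, 'i, 'm) surface_scheme \<Rightarrow> bool" where
  "riemann_surface M \<longleftrightarrow>
     (\<Union>i\<in>idx M. cdom M i) = UNIV \<and>
     (\<forall>i\<in>idx M. open (cdom M i) \<and> open (coord M i ` cdom M i) \<and>
        (\<exists>h. homeomorphism (cdom M i) (coord M i ` cdom M i) (coord M i) h)) \<and>
     (\<forall>i\<in>idx M. \<forall>j\<in>idx M.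
        in_chart M i (coord M j) holomorphic_on coord M i ` (cdom M i \<inter> cdom M j))"

definition hermitian_metric :: "('a::t2_space, 'i, 'm) surface_scheme \<Rightarrow> bool" where
  "hermitian_metric M \<longleftrightarrow>
     (\<forall>i\<in>idx M. (\<forall>p\<in>cdom M i. dens M i p > 0) \<and>
        smooth_on (in_chart M i (dens M i)) (coord M i ` cdom M i)) \<and>
     (\<forall>i\<in>idx M. \<forall>j\<in>idx M. \<forall>p\<in>cdom M i \<inter> cdom M j.
        dens M i p = dens M j p * (norm (jac M i j p))\<^sup>2)"

definition holomorphic_line_bundle :: "('a::t2_space, 'i, 'm) spin_surface_scheme \<Rightarrow> bool" where
  "holomorphic_line_bundle M \<longleftrightarrow>
     (\<forall>i\<in>idx M. \<forall>j\<in>idx M.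
        (\<forall>p\<in>cdom M i \<inter> cdom M j. cocycle M i j p \<noteq> 0) \<and>
        in_chart M i (cocycle M i j) holomorphic_on coord M i ` (cdom M i \<inter> cdom M j)) \<and>
     (\<forall>i\<in>idx M. \<forall>p\<in>cdom M i. cocycle M i i p = 1) \<and>
     (\<forall>i\<in>idx M. \<forall>j\<in>idx M. \<forall>k\<in>idx M. \<forall>p\<in>cdom M i \<inter> cdom M j \<inter> cdom M k.
        cocycle M i j p * cocycle M j k p = cocycle M i k p)"

definition square_is_canonical :: "('a::t2_space, 'i, 'm) spin_surface_scheme \<Rightarrow> bool" where
  "square_is_canonical M \<longleftrightarrow>
     (\<forall>i\<in>idx M. (\<forall>p\<in>cdom M i. quad M i p \<noteq> 0) \<and>
        in_chart M i (quad M i) holomorphic_on coord M i ` cdom M i) \<and>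
     (\<forall>i\<in>idx M. \<forall>j\<in>idx M. \<forall>p\<in>cdom M i \<inter> cdom M j.
        (cocycle M i j p)\<^sup>2 * quad M i p = quad M j p * jac M i j p)"

definition compact_spin_surface :: "('a::t2_space, 'i, 'm) spin_surface_scheme \<Rightarrow> bool" where
  "compact_spin_surface M \<longleftrightarrow> compact (UNIV :: 'a set) \<and>
     riemann_surface M \<and> hermitian_metric M \<and>
     holomorphic_line_bundle M \<and> square_is_canonical M"

text \<open>
  Tangent vectors at a point of \<open>cdom M i\<close> are complex numbers, \<open>X = X\<^sub>1 + \<i> X\<^sub>2\<close> standing for
  \<open>X\<^sub>1 \<partial>\<^sub>x + X\<^sub>2 \<partial>\<^sub>y\<close>.  All functions of \<open>w\<close> below live on \<open>coord M i ` cdom M i\<close>.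
\<close>

definition surf_metric :: "('a, 'i, 'm) surface_scheme \<Rightarrow> 'i \<Rightarrow> complex \<Rightarrow> complex \<Rightarrow> complex \<Rightarrow> real"
  where "surf_metric M i w X Y = in_chart M i (dens M i) w * (X \<bullet> Y)"

section \<open>Spinors\<close>

text \<open>
  A spinor field is a pair of coordinate families: \<open>\<psi>\<^sub>+ = (fst \<psi> i) e\<^sub>i\<close> and
  \<open>\<psi>\<^sub>- = (snd \<psi> i) cnj e\<^sub>i\<close> over \<open>cdom M i\<close>.
\<close>

type_synonym ('a, 'i) spinor = "('i \<Rightarrow> 'a \<Rightarrow> complex) \<times> ('i \<Rightarrow> 'a \<Rightarrow> complex)"

definition spinor_field :: "('a, 'i, 'm) spin_surface_scheme \<Rightarrow> ('a, 'i) spinor \<Rightarrow> bool" where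
  "spinor_field M \<psi> \<longleftrightarrow>
     (\<forall>i\<in>idx M. smooth_on (in_chart M i (fst \<psi> i)) (coord M i ` cdom M i) \<and>
        smooth_on (in_chart M i (snd \<psi> i)) (coord M i ` cdom M i)) \<and>
     (\<forall>i\<in>idx M. \<forall>j\<in>idx M. \<forall>p\<in>cdom M i \<inter> cdom M j.
        fst \<psi> i p = cocycle M i j p * fst \<psi> j p \<and>
        snd \<psi> i p = cnj (cocycle M i j p) * snd \<psi> j p)"

text \<open>
  \<open>spin_frame M i V r\<close> says that \<open>s\<^sub>0 = r\<^sup>-\<^sup>1 e\<^sub>i\<close> is a holomorphic section over
  \<open>V\<close> with \<open>s\<^sub>0 \<otimes> s\<^sub>0 = dz\<^sub>i\<close>.
  Then \<open>\<psi>\<^sub>+ = f\<^sub>+ s\<^sub>0\<close> and \<open>\<psi>\<^sub>- = f\<^sub>- cnj s\<^sub>0\<close> with \<open>(f\<^sub>+, f\<^sub>-) = spin_comp M i r \<psi>\<close>.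
\<close>

definition spin_frame ::
  "('a, 'i, 'm) spin_surface_scheme \<Rightarrow> 'i \<Rightarrow> complex set \<Rightarrow> (complex \<Rightarrow> complex) \<Rightarrow> bool" where
  "spin_frame M i V r \<longleftrightarrow> i \<in> idx M \<and> open V \<and> V \<subseteq> coord M i ` cdom M i \<and>
     r holomorphic_on V \<and> (\<forall>w\<in>V. (r w)\<^sup>2 = in_chart M i (quad M i) w)"

definition spin_comp ::
  "('a, 'i, 'm) spin_surface_scheme \<Rightarrow> 'i \<Rightarrow> (complex \<Rightarrow> complex) \<Rightarrow> ('a, 'i) spinor \<Rightarrow>
   complex \<Rightarrow> complex \<times> complex" where
  "spin_comp M i r \<psi> w =
     (r w * in_chart M i (fst \<psi> i) w, cnj (r w) * in_chart M i (snd \<psi> i) w)"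

text \<open>\<open>|s\<^sub>0|\<^sup>2\<close>, determined by \<open>g = |s\<^sub>0|\<^sup>-\<^sup>4 (dx\<^sup>2 + dy\<^sup>2)\<close>.\<close>

definition s0_sqnorm :: "('a, 'i, 'm) surface_scheme \<Rightarrow> 'i \<Rightarrow> complex \<Rightarrow> real" where
  "s0_sqnorm M i w = 1 / sqrt (in_chart M i (dens M i) w)"

text \<open>In the following operators \<open>N\<close> is \<open>|s\<^sub>0|\<^sup>2\<close>, and sections are given by their
  components with respect to \<open>s\<^sub>0\<close> and \<open>cnj s\<^sub>0\<close>.\<close>

definition del_g :: "(complex \<Rightarrow> real) \<Rightarrow> (complex \<Rightarrow> complex) \<Rightarrow> complex \<Rightarrow> complex" where
  "del_g N f w = of_real (N w) * d_z f w"

definition delbar_g :: "(complex \<Rightarrow> real) \<Rightarrow> (complex \<Rightarrow> complex) \<Rightarrow> complex \<Rightarrow> complex" where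
  "delbar_g N f w = of_real (N w) * d_zbar f w"

definition dirac ::
  "(complex \<Rightarrow> real) \<Rightarrow> (complex \<Rightarrow> complex \<times> complex) \<Rightarrow> complex \<Rightarrow> complex \<times> complex" where
  "dirac N f w = (2 * del_g N (snd \<circ> f) w, - 2 * delbar_g N (fst \<circ> f) w)"

definition eigenspinor ::
  "('a, 'i, 'm) spin_surface_scheme \<Rightarrow> real \<Rightarrow> ('a, 'i) spinor \<Rightarrow> bool" where
  "eigenspinor M lam \<psi> \<longleftrightarrow> spinor_field M \<psi> \<and>
     (\<exists>i\<in>idx M. \<exists>p\<in>cdom M i. fst \<psi> i p \<noteq> 0 \<or> snd \<psi> i p \<noteq> 0) \<and>
     (\<forall>i V r. spin_frame M i V r \<longrightarrow> (\<forall>w\<in>V.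
        dirac (s0_sqnorm M i) (spin_comp M i r \<psi>) w =
          (of_real lam * fst (spin_comp M i r \<psi> w), of_real lam * snd (spin_comp M i r \<psi> w))))"

text \<open>A complexified tangent vector \<open>a \<partial>\<^sub>z + b \<partial>\<^sub>z\<^sub>b\<^sub>a\<^sub>r\<close> is the pair \<open>(a, b)\<close>.\<close>

definition complexify :: "complex \<Rightarrow> complex \<times> complex" where
  "complexify X = (X, cnj X)"

definition conj_vec :: "complex \<times> complex \<Rightarrow> complex \<times> complex" where
  "conj_vec X = (cnj (snd X), cnj (fst X))"

text \<open>The connection form of the Chern connection in the holomorphic frame \<open>s\<^sub>0\<close> is
  \<open>\<partial> log |s\<^sub>0|\<^sup>2\<close>.\<close>

definition chern_connection ::
  "(complex \<Rightarrow> real) \<Rightarrow> complex \<times> complex \<Rightarrow> (complex \<Rightarrow> complex) \<Rightarrow> complex \<Rightarrow> complex" where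
  "chern_connection N X f w =
     fst X * (d_z f w + f w * d_z (\<lambda>u. of_real (ln (N u))) w) + snd X * d_zbar f w"

definition clifford_connection ::
  "(complex \<Rightarrow> real) \<Rightarrow> complex \<times> complex \<Rightarrow> (complex \<Rightarrow> complex \<times> complex) \<Rightarrow>
   complex \<Rightarrow> complex \<times> complex" where
  "clifford_connection N X f w =
     (chern_connection N X (fst \<circ> f) w,
      cnj (chern_connection N (conj_vec X) (cnj \<circ> snd \<circ> f) w))"

definition clifford_mult ::
  "(complex \<Rightarrow> real) \<Rightarrow> complex \<Rightarrow> complex \<times> complex \<Rightarrow> complex \<times> complex \<Rightarrow> complex \<times> complex" where
  "clifford_mult N w X s = (snd X * snd s / of_real (N w), - fst X * fst s / of_real (N w))"

definition spinor_herm ::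
  "(complex \<Rightarrow> real) \<Rightarrow> complex \<Rightarrow> complex \<times> complex \<Rightarrow> complex \<times> complex \<Rightarrow> complex" where
  "spinor_herm N w s t = of_real (N w) * (fst s * cnj (fst t) + snd s * cnj (snd t))"

definition energy_momentum ::
  "(complex \<Rightarrow> real) \<Rightarrow> (complex \<Rightarrow> complex \<times> complex) \<Rightarrow> complex \<Rightarrow> complex \<Rightarrow> complex \<Rightarrow> real" where
  "energy_momentum N f w X Y = 1/2 * Re (
     spinor_herm N w
       (clifford_mult N w (complexify X) (clifford_connection N (complexify Y) f w)) (f w) +
     spinor_herm N w
       (clifford_mult N w (complexify Y) (clifford_connection N (complexify X) f w)) (f w))"

section \<open>Complex projective space with the Fubini--Study metric\<close>

text \<open>The projective space of lines in \<open>complex ^ 'n\<close>; its complex dimension is \<open>CARD('n) - 1\<close>.\<close>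

typedef (overloaded) ('n::finite) cproj =
  "{L :: (complex ^ 'n) set. \<exists>F. F \<noteq> 0 \<and> L = vec.span {F}}"
  by (rule exI[of _ "vec.span {axis undefined 1}"]) (auto intro!: exI[of _ "axis undefined 1"])

definition homogeneous_coords :: "'n::finite cproj \<Rightarrow> complex ^ 'n \<Rightarrow> bool" where
  "homogeneous_coords P F \<longleftrightarrow> F \<noteq> 0 \<and> Rep_cproj P = vec.span {F}"

text \<open>
  The affine chart \<open>k\<close> takes values in the affine hyperplane \<open>{F. F $ k = 1}\<close>, whose
  direction space is \<open>aff_dir k\<close>.
\<close>

definition aff_dom :: "'n::finite \<Rightarrow> 'n cproj set" where
  "aff_dom k = {P. \<exists>F\<in>Rep_cproj P. F $ k \<noteq> 0}"

definition aff_chart :: "'n::finite \<Rightarrow> 'n cproj \<Rightarrow> complex ^ 'n" where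
  "aff_chart k P = (THE F. F \<in> Rep_cproj P \<and> F $ k = 1)"

definition aff_dir :: "'n::finite \<Rightarrow> (complex ^ 'n) set" where
  "aff_dir k = {X. X $ k = 0}"

definition hinner :: "complex ^ 'n::finite \<Rightarrow> complex ^ 'n \<Rightarrow> complex" where
  "hinner X Y = (\<Sum>i\<in>UNIV. X $ i * cnj (Y $ i))"

definition fubini_study :: "complex ^ 'n::finite \<Rightarrow> complex ^ 'n \<Rightarrow> complex ^ 'n \<Rightarrow> real" where
  "fubini_study F X Y = Re (hinner F F * hinner X Y - hinner X F * hinner F Y) / norm F ^ 4"

section \<open>Branched minimal immersions\<close>

text \<open>
  A metric \<open>h\<close> on (an open subset of) an affine space with direction space \<open>V\<close>.  The
  Levi-Civita connection is \<open>D\<^sub>X Y + christoffel V h x X Y\<close>, with \<open>christoffel\<close> given by the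
  Koszul formula for constant vector fields.
\<close>

definition christoffel ::
  "'b::real_normed_vector set \<Rightarrow> ('b \<Rightarrow> 'b \<Rightarrow> 'b \<Rightarrow> real) \<Rightarrow> 'b \<Rightarrow> 'b \<Rightarrow> 'b \<Rightarrow> 'b" where
  "christoffel V h x X Y = (THE \<Gamma>. \<Gamma> \<in> V \<and> (\<forall>Z\<in>V. h x \<Gamma> Z =
     1/2 * (frechet_derivative (\<lambda>y. h y Y Z) (at x) X +
            frechet_derivative (\<lambda>y. h y X Z) (at x) Y -
            frechet_derivative (\<lambda>y. h y X Y) (at x) Z)))"

text \<open>The covariant derivative \<open>\<nabla>\<^sub>X (df Y)\<close> along \<open>f\<close>, for constant vector fields \<open>X\<close>, \<open>Y\<close>.\<close>

definition cov_deriv_along ::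
  "'b::real_normed_vector set \<Rightarrow> ('b \<Rightarrow> 'b \<Rightarrow> 'b \<Rightarrow> real) \<Rightarrow> (complex \<Rightarrow> 'b) \<Rightarrow>
   complex \<Rightarrow> complex \<Rightarrow> complex \<Rightarrow> 'b" where
  "cov_deriv_along V h f w X Y =
     frechet_derivative (\<lambda>u. frechet_derivative f (at u) Y) (at w) X +
     christoffel V h (f w) (frechet_derivative f (at w) X) (frechet_derivative f (at w) Y)"

definition pullback_metric ::
  "('b::real_normed_vector \<Rightarrow> 'b \<Rightarrow> 'b \<Rightarrow> real) \<Rightarrow> (complex \<Rightarrow> 'b) \<Rightarrow>
   complex \<Rightarrow> complex \<Rightarrow> complex \<Rightarrow> real" where
  "pullback_metric h f w X Y =
     h (f w) (frechet_derivative f (at w) X) (frechet_derivative f (at w) Y)"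

definition normal_vector ::
  "'b::real_normed_vector set \<Rightarrow> ('b \<Rightarrow> 'b \<Rightarrow> 'b \<Rightarrow> real) \<Rightarrow> (complex \<Rightarrow> 'b) \<Rightarrow>
   complex \<Rightarrow> 'b \<Rightarrow> bool" where
  "normal_vector V h f w \<nu> \<longleftrightarrow> \<nu> \<in> V \<and> (\<forall>X. h (f w) (frechet_derivative f (at w) X) \<nu> = 0)"

text \<open>The second fundamental form in the normal direction \<open>\<nu>\<close>; the tangential part of
  \<open>\<nabla>\<^sub>X (df Y)\<close> is orthogonal to \<open>\<nu>\<close>.\<close>

definition second_fundamental_form ::
  "'b::real_normed_vector set \<Rightarrow> ('b \<Rightarrow> 'b \<Rightarrow> 'b \<Rightarrow> real) \<Rightarrow> (complex \<Rightarrow> 'b) \<Rightarrow>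
   complex \<Rightarrow> 'b \<Rightarrow> complex \<Rightarrow> complex \<Rightarrow> real" where
  "second_fundamental_form V h f w \<nu> X Y = h (f w) (cov_deriv_along V h f w X Y) \<nu>"

text \<open>Vanishing mean curvature: in each normal direction the second fundamental form is
  trace-free with respect to the induced metric.\<close>

definition minimal_at ::
  "'b::real_normed_vector set \<Rightarrow> ('b \<Rightarrow> 'b \<Rightarrow> 'b \<Rightarrow> real) \<Rightarrow> (complex \<Rightarrow> 'b) \<Rightarrow> complex \<Rightarrow> bool" where
  "minimal_at V h f w \<longleftrightarrow> (\<forall>\<nu> X Y. normal_vector V h f w \<nu> \<and>
     pullback_metric h f w X X = 1 \<and> pullback_metric h f w Y Y = 1 \<and>
     pullback_metric h f w X Y = 0 \<longrightarrow>
     second_fundamental_form V h f w \<nu> X X + second_fundamental_form V h f w \<nu> Y Y = 0)"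

text \<open>Since \<open>\<alpha> > 0\<close>, this includes injectivity of the differential.\<close>

definition conformal_immersion_at ::
  "(complex \<Rightarrow> complex \<Rightarrow> complex \<Rightarrow> real) \<Rightarrow> ('b::real_normed_vector \<Rightarrow> 'b \<Rightarrow> 'b \<Rightarrow> real) \<Rightarrow>
   (complex \<Rightarrow> 'b) \<Rightarrow> complex \<Rightarrow> bool" where
  "conformal_immersion_at g h f w \<longleftrightarrow>
     (\<exists>\<alpha>>0. \<forall>X Y. pullback_metric h f w X Y = \<alpha> * g w X Y)"

text \<open>
  A branch point in the sense of Gulliver, Osserman and Royden: up to higher order terms, to
  first order in the derivatives, \<open>f\<close> looks like \<open>z \<mapsto> z\<^sup>m\<close> with \<open>m \<ge> 2\<close>, followed by an
  injective real-linear map of the plane.  For a map that is conformal elsewhere, a holomorphic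
  coordinate can be used for \<open>z\<close>.  Such points are isolated.
\<close>

definition branch_point_at :: "(complex \<Rightarrow> 'b::real_normed_vector) \<Rightarrow> complex \<Rightarrow> bool" where
  "branch_point_at f w \<longleftrightarrow> (\<exists>m\<ge>2. \<exists>L. bounded_linear L \<and> inj L \<and>
     ((\<lambda>u. (f u - f w - L ((u - w) ^ m)) /\<^sub>R norm (u - w) ^ m) \<longlongrightarrow> 0) (at w) \<and>
     ((\<lambda>u. onorm (\<lambda>v. frechet_derivative f (at u) v - L (of_nat m * (u - w) ^ (m - 1) * v))
            / norm (u - w) ^ (m - 1)) \<longlongrightarrow> 0) (at w))"

text \<open>
  Maps from \<open>M\<close> to \<open>CP\<close>, the latter with \<open>c\<close> times the Fubini--Study metric, expressed in the
  charts \<open>coord M i\<close> and \<open>aff_chart k\<close>.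
\<close>

definition chart_dom ::
  "('a, 'i, 'm) surface_scheme \<Rightarrow> ('a \<Rightarrow> 'n::finite cproj) \<Rightarrow> 'i \<Rightarrow> 'n \<Rightarrow> complex set" where
  "chart_dom M \<Psi> i k = coord M i ` {p \<in> cdom M i. \<Psi> p \<in> aff_dom k}"

definition chart_map ::
  "('a, 'i, 'm) surface_scheme \<Rightarrow> ('a \<Rightarrow> 'n::finite cproj) \<Rightarrow> 'i \<Rightarrow> 'n \<Rightarrow> complex \<Rightarrow> complex ^ 'n"
  where "chart_map M \<Psi> i k = in_chart M i (aff_chart k \<circ> \<Psi>)"

definition smooth_map :: "('a, 'i, 'm) surface_scheme \<Rightarrow> ('a \<Rightarrow> 'n::finite cproj) \<Rightarrow> bool" where
  "smooth_map M \<Psi> \<longleftrightarrow> (\<forall>i\<in>idx M. \<forall>k.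
     open (chart_dom M \<Psi> i k) \<and> smooth_on (chart_map M \<Psi> i k) (chart_dom M \<Psi> i k))"

definition branched_minimal_immersion ::
  "real \<Rightarrow> ('a, 'i, 'm) surface_scheme \<Rightarrow> ('a \<Rightarrow> 'n::finite cproj) \<Rightarrow> bool" where
  "branched_minimal_immersion c M \<Psi> \<longleftrightarrow> smooth_map M \<Psi> \<and>
     (let h = (\<lambda>F X Y. c * fubini_study F X Y) in
      \<forall>i\<in>idx M. \<forall>k. \<forall>w\<in>chart_dom M \<Psi> i k.
        conformal_immersion_at (surf_metric M i) h (chart_map M \<Psi> i k) w \<and>
        minimal_at (aff_dir k) h (chart_map M \<Psi> i k) w
      \<or> branch_point_at (chart_map M \<Psi> i k) w)"

text \<open>The vector with entries \<open>\<psi>\<^sub>j\<^sub>+\<close> and \<open>cnj \<psi>\<^sub>j\<^sub>-\<close>, all with respect to the frame \<open>e\<^sub>i\<close> of \<open>S\<close>.\<close>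

definition spinor_coords ::
  "('m::finite \<Rightarrow> ('a, 'i) spinor) \<Rightarrow> 'i \<Rightarrow> 'a \<Rightarrow> complex ^ ('m \<times> bool)" where
  "spinor_coords \<psi> i p =
     (\<chi> x. if snd x then fst (\<psi> (fst x)) i p else cnj (snd (\<psi> (fst x)) i p))"

end

theory Submission
  imports Defs
begin

text \<open>
  In the frame \<open>s\<^sub>0\<close> the lift \<open>F\<close> of the map has components \<open>a\<^sub>j\<close>, \<open>B\<^sub>j\<close> with \<open>\<psi>\<^sub>j\<^sub>+ = a\<^sub>j s\<^sub>0\<close> and
  \<open>\<psi>\<^sub>j\<^sub>- = cnj B\<^sub>j cnj s\<^sub>0\<close>.  With the quaternionic structure \<open>J (a, B) = (- cnj B, cnj a)\<close> and
  \<open>N = |s\<^sub>0|\<^sup>2\<close>, the Dirac equation says \<open>\<partial>\<^bsub>zbar\<^esub> F = lam / (2 N) J F\<close>.  The trace part of the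
  condition on the energy-momentum tensors is \<open>|F|\<^sup>2 = 1 / N\<close>, its trace-free part is
  \<open>\<langle>\<partial>\<^sub>z F, J F\<rangle> = 0\<close>.  Since \<open>J F\<close> is orthogonal to \<open>F\<close>, the latter says that the map is conformal,
  and since \<open>J F\<close> never vanishes, neither does the \<open>\<partial>\<^bsub>zbar\<^esub>\<close> part of the differential, so there are
  no branch points at all.  Differentiating
  \<open>\<partial>\<^bsub>zbar\<^esub> F = (lam / 2) |F|\<^sup>2 J F\<close> once more and using \<open>J\<^sup>2 = - 1\<close> shows that the map is harmonic,
  hence minimal.
\<close>

no_notation fps_nth (infixl "$" 75)

section \<open>Differentiability classes and second derivatives\<close>

lemma Ck_on_cong:
  assumes "open S" "\<And>x. x \<in> S \<Longrightarrow> f x = g x" "Ck_on k f S"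
  shows "Ck_on k g S"
  using assms(2,3)
proof (induction k arbitrary: f g)
  case 0
  then show ?case using continuous_on_cong by fastforce
next
  case (Suc k)
  have d: "(g has_derivative frechet_derivative f (at x)) (at x)" if "x \<in> S" for x
    using Suc.prems that assms(1)
    by (auto simp: frechet_derivative_works intro: has_derivative_transform_within_open)
  moreover have "frechet_derivative f (at x) = frechet_derivative g (at x)" if "x \<in> S" for x
    using d[OF that] by (rule frechet_derivative_at)
  then have "Ck_on k (\<lambda>x. frechet_derivative g (at x) v) S" for v
    using Suc.IH[of "\<lambda>x. frechet_derivative f (at x) v"] Suc.prems(2) by auto
  ultimately show ?case by (auto intro: differentiableI)
qed

text \<open>\<open>Ck_on\<close> refers to \<open>frechet_derivative\<close>; this rule accepts any
  explicit derivative on an open set instead, which is how all closure properties below are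
  proved.\<close>

lemma Ck_on_SucI:
  assumes "open S" "\<And>x. x \<in> S \<Longrightarrow> (f has_derivative f' x) (at x)"
    and "\<And>v. Ck_on k (\<lambda>x. f' x v) S"
  shows "Ck_on (Suc k) f S"
proof -
  have "Ck_on k (\<lambda>x. frechet_derivative f (at x) v) S" for v
    using assms(3)[of v] frechet_derivative_at[OF assms(2)]
    by (auto intro: Ck_on_cong[OF assms(1), of "\<lambda>x. f' x v"])
  then show ?thesis using assms(2) by (auto intro: differentiableI)
qed

lemma Ck_on_Suc_imp: "Ck_on (Suc k) f S \<Longrightarrow> Ck_on k f S"
proof (induction k arbitrary: f)
  case 0
  then show ?case
    by (auto intro!: continuous_at_imp_continuous_on differentiable_imp_continuous_within)
next
  case (Suc k)
  then show ?case by (subst Ck_on.simps) (metis Ck_on.simps(2))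
qed

lemma Ck_on_const: "Ck_on k (\<lambda>x. c) S"
  by (induction k arbitrary: c) auto

lemma Ck_on_add:
  assumes "open S" "Ck_on k f S" "Ck_on k g S"
  shows "Ck_on k (\<lambda>x. f x + g x) S"
  using assms(2,3)
proof (induction k arbitrary: f g)
  case (Suc k)
  show ?case
    by (rule Ck_on_SucI[OF assms(1), where f' = "\<lambda>x v. frechet_derivative f (at x) v + frechet_derivative g (at x) v"])
      (use Suc in \<open>auto intro!: has_derivative_add simp: frechet_derivative_works\<close>)
qed (auto intro: continuous_intros)

lemma Ck_on_sum:
  assumes "open S" "\<And>i. i \<in> I \<Longrightarrow> Ck_on k (f i) S"
  shows "Ck_on k (\<lambda>x. \<Sum>i\<in>I. f i x) S"
  using assms(2)
  by (induction I rule: infinite_finite_induct) (auto intro: Ck_on_const Ck_on_add[OF assms(1)])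

lemma Ck_on_bounded_linear:
  assumes "bounded_linear L" "open S" "Ck_on k f S"
  shows "Ck_on k (\<lambda>x. L (f x)) S"
  using assms(3)
proof (induction k arbitrary: f)
  case 0
  then show ?case using bounded_linear.continuous_on[OF assms(1)] by auto
next
  case (Suc k)
  show ?case
    by (rule Ck_on_SucI[OF assms(2), where f' = "\<lambda>x v. L (frechet_derivative f (at x) v)"])
      (use Suc in \<open>auto simp: frechet_derivative_works intro!: bounded_linear.has_derivative[OF assms(1)]\<close>)
qed

lemma Ck_on_bounded_bilinear:
  assumes "bounded_bilinear B" "open S" "Ck_on k f S" "Ck_on k g S"
  shows "Ck_on k (\<lambda>x. B (f x) (g x)) S"
  using assms(3,4)
proof (induction k arbitrary: f g)
  case 0
  then show ?case using bounded_bilinear.continuous_on[OF assms(1)] by auto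
next
  case (Suc k)
  show ?case
    by (rule Ck_on_SucI[OF assms(2), where f' = "\<lambda>x v. B (f x) (frechet_derivative g (at x) v)
         + B (frechet_derivative f (at x) v) (g x)"])
      (use Suc Ck_on_Suc_imp[OF Suc.prems(1)] Ck_on_Suc_imp[OF Suc.prems(2)] in
        \<open>auto simp: frechet_derivative_works intro!: Ck_on_add[OF assms(2)]
           bounded_bilinear.FDERIV[OF assms(1)]\<close>)
qed

text \<open>The derivative of \<open>inverse (f x)\<close> contains \<open>inverse (f x)\<close>
  again, so the induction on \<open>k\<close> keeps \<open>f\<close> fixed: the induction hypothesis
  supplies class C^k for this factor.\<close>

lemma Ck_on_inverse:
  fixes f :: "'a::real_normed_vector \<Rightarrow> 'b::real_normed_field"
  assumes "open S" "\<And>x. x \<in> S \<Longrightarrow> f x \<noteq> 0" "Ck_on k f S"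
  shows "Ck_on k (\<lambda>x. inverse (f x)) S"
  using assms(3)
proof (induction k)
  case 0
  then show ?case using assms(2) by (auto intro: continuous_intros)
next
  case (Suc k)
  note bl = bounded_bilinear_mult
  have "Ck_on k (\<lambda>x. - (inverse (f x) * frechet_derivative f (at x) v * inverse (f x))) S" for v
    using Suc Ck_on_Suc_imp[OF Suc.prems] assms(1)
    by (intro Ck_on_bounded_linear[OF bounded_linear_minus[OF bounded_linear_ident]]
          Ck_on_bounded_bilinear[OF bl]) auto
  then show ?case
    using Suc.prems assms(2)
    by (intro Ck_on_SucI[OF assms(1), where f' = "\<lambda>x v. - (inverse (f x) * frechet_derivative f (at x) v * inverse (f x))"])
      (auto simp: frechet_derivative_works intro!: Deriv.has_derivative_inverse)
qed

lemma bounded_linear_axis: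
  "bounded_linear (axis i :: 'b::real_normed_vector \<Rightarrow> 'b ^ 'n::finite)"
proof (rule bounded_linear_intro[where K = 1])
  show "norm (axis i x :: 'b ^ 'n) \<le> norm x * 1" for x
    using L2_set_le_sum[of UNIV "\<lambda>j. norm ((axis i x :: 'b ^ 'n) $ j)"]
    by (simp add: norm_vec_def axis_def if_distrib[of norm] cong: if_cong)
qed (auto simp: vec_eq_iff axis_def)

text \<open>A vector-valued map becomes a finite sum of bounded linear images of its components, so
  the rules for sums and bounded linear maps carry over.\<close>

lemma vec_lambda_eq_sum_axis:
  "(\<chi> i. f i) = (\<Sum>i\<in>UNIV. axis i (f i :: 'b::real_normed_vector))"
  by (simp add: vec_eq_iff axis_def if_distrib[of "\<lambda>v. v $ j" for j] cong: if_cong)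

lemma has_derivative_vec_lambda:
  assumes "\<And>i. ((\<lambda>x. f x i) has_derivative (\<lambda>v. f' v i)) (at x within S)"
  shows "((\<lambda>x. \<chi> i. f x i) has_derivative (\<lambda>v. \<chi> i. f' v i)) (at x within S)"
  unfolding vec_lambda_eq_sum_axis
  by (intro has_derivative_sum bounded_linear.has_derivative[OF bounded_linear_axis] assms)

lemma Ck_on_vec_lambda:
  assumes "open S" "\<And>i. Ck_on k (\<lambda>x. f x i) S"
  shows "Ck_on k (\<lambda>x. \<chi> i. f x i) S"
  unfolding vec_lambda_eq_sum_axis
  using assms by (auto intro!: Ck_on_sum Ck_on_bounded_linear[OF bounded_linear_axis])

lemma Ck_on_subset: "T \<subseteq> S \<Longrightarrow> Ck_on k f S \<Longrightarrow> Ck_on k f T"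
  by (induction k arbitrary: f) (auto intro: continuous_on_subset)

lemma smooth_on_cong:
  "open S \<Longrightarrow> (\<And>x. x \<in> S \<Longrightarrow> f x = g x) \<Longrightarrow> smooth_on f S \<Longrightarrow> smooth_on g S"
  unfolding smooth_on_def by (metis Ck_on_cong)

lemma smooth_on_subset: "T \<subseteq> S \<Longrightarrow> smooth_on f S \<Longrightarrow> smooth_on f T"
  unfolding smooth_on_def by (metis Ck_on_subset)

lemma smooth_on_imp_differentiable: "smooth_on f S \<Longrightarrow> x \<in> S \<Longrightarrow> f differentiable (at x)"
  unfolding smooth_on_def by (metis Ck_on.simps(2))

lemma smooth_on_imp_continuous_on: "smooth_on f S \<Longrightarrow> continuous_on S f"
  unfolding smooth_on_def by (metis Ck_on.simps(1))

lemma smooth_on_imp_frechet_differentiable: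
  assumes "smooth_on f S" "x \<in> S"
  shows "(\<lambda>u. frechet_derivative f (at u) v) differentiable (at x)"
proof -
  have "Ck_on (Suc (Suc 0)) f S" using assms(1) smooth_on_def by blast
  then show ?thesis using assms(2) by simp
qed

section \<open>Symmetry of second derivatives\<close>

text \<open>The second difference over the parallelogram with sides \<open>h a\<close> and
  \<open>h b\<close> is \<open>h^2 D a\<close> up to o(h^2). It is the increment over [0, h] of f(w
  + h a + t b) - f(w + t b), whose derivative in \<open>t\<close> is a difference of derivatives
  along \<open>b\<close>, close to \<open>h D a\<close> by differentiability at \<open>w\<close>.
  The mean value inequality then gives the bound.\<close>

lemma second_difference_bound:
  fixes f :: "'a::real_normed_vector \<Rightarrow> 'b::euclidean_space"
  assumes "open V" "w \<in> V" "\<And>u. u \<in> V \<Longrightarrow> f differentiable (at u)"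
    and "((\<lambda>u. frechet_derivative f (at u) b) has_derivative D) (at w)" and "e > 0"
  shows "\<exists>d>0. \<forall>h. 0 < h \<and> h < d \<longrightarrow>
    norm (f (w + h *\<^sub>R a + h *\<^sub>R b) - f (w + h *\<^sub>R a) - f (w + h *\<^sub>R b) + f w - h\<^sup>2 *\<^sub>R D a) \<le> e * h\<^sup>2"
proof -
  let ?g = "\<lambda>u. frechet_derivative f (at u) b"
  \<comment> \<open>With this \<open>C\<close> one has |h a + t b| + |t b| <= h C for 0 <= t <= h,
    so two linearisation errors with constant \<open>e / C\<close> add up to at most
    \<open>e h\<close>. The summand 1 keeps \<open>C\<close> positive.\<close>
  define C where "C = norm a + 2 * norm b + 1"
  have C: "C > 0" by (simp add: C_def add_nonneg_pos)
  define e' where "e' = e / C"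
  have e': "e' > 0" using assms(5) C by (simp add: e'_def)
  obtain d1 where d1: "d1 > 0" "\<And>u. norm (u - w) < d1 \<Longrightarrow> norm (?g u - ?g w - D (u - w)) \<le> e' * norm (u - w)"
    using assms(4) e' unfolding has_derivative_at_alt by blast
  obtain d2 where d2: "d2 > 0" "ball w d2 \<subseteq> V"
    using assms(1,2) openE by blast
  interpret D: bounded_linear D using assms(4) by (rule has_derivative_bounded_linear)
  define d where "d = min d1 d2 / C"
  have d: "d > 0" using d1 d2 C by (simp add: d_def)
  moreover have "norm (f (w + h *\<^sub>R a + h *\<^sub>R b) - f (w + h *\<^sub>R a) - f (w + h *\<^sub>R b) + f w - h\<^sup>2 *\<^sub>R D a) \<le> e * h\<^sup>2"
    if h: "0 < h" "h < d" for h
  proof -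
    have small: "norm (s *\<^sub>R a + t *\<^sub>R b) < min d1 d2" if "s \<in> {0..h}" "t \<in> {0..h}" for s t
    proof -
      have "norm (s *\<^sub>R a + t *\<^sub>R b) \<le> s * norm a + t * norm b"
        using that by (intro order_trans[OF norm_triangle_ineq]) auto
      also have "\<dots> \<le> h * norm a + h * norm b"
        using that by (intro add_mono mult_right_mono) auto
      also have "\<dots> \<le> h * C"
        using h by (simp add: C_def algebra_simps)
      also have "\<dots> < min d1 d2"
        using h(2) C by (simp add: d_def field_simps)
      finally show ?thesis .
    qed
    have inV: "w + s *\<^sub>R a + t *\<^sub>R b \<in> V" if "s \<in> {0..h}" "t \<in> {0..h}" for s t
    proof -
      have "w + (s *\<^sub>R a + t *\<^sub>R b) \<in> ball w d2"
        using small[OF that] by (metis add_diff_cancel_left' dist_commute dist_norm mem_ball min_less_iff_conj)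
      then show ?thesis using d2(2) by (auto simp: add.assoc)
    qed
    define p where "p t = f (w + h *\<^sub>R a + t *\<^sub>R b) - f (w + t *\<^sub>R b) - t *\<^sub>R (h *\<^sub>R D a)" for t
    have der: "((\<lambda>t. f (w + s *\<^sub>R a + t *\<^sub>R b)) has_derivative (\<lambda>y. y *\<^sub>R ?g (w + s *\<^sub>R a + t *\<^sub>R b))) (at t)"
      if "s \<in> {0..h}" "t \<in> {0..h}" for s t
    proof -
      have f: "(f has_derivative frechet_derivative f (at (w + s *\<^sub>R a + t *\<^sub>R b))) (at (w + s *\<^sub>R a + t *\<^sub>R b))"
        using assms(3)[OF inV[OF that]] frechet_derivative_works by blast
      have "((\<lambda>t. w + s *\<^sub>R a + t *\<^sub>R b) has_derivative (\<lambda>y. y *\<^sub>R b)) (at t)"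
        by (auto intro!: derivative_eq_intros)
      from diff_chain_at[OF this f] show ?thesis
        using linear_cmul[OF bounded_linear.linear[OF has_derivative_bounded_linear[OF f]]]
        by (simp add: o_def)
    qed
    have pd: "(p has_derivative (\<lambda>y. y *\<^sub>R (?g (w + h *\<^sub>R a + t *\<^sub>R b) - ?g (w + t *\<^sub>R b) - h *\<^sub>R D a))) (at t within {0..h})"
      if "t \<in> {0..h}" for t
      using der[of h t] der[of 0 t] that h unfolding p_def
      by (auto intro!: derivative_eq_intros has_derivative_at_withinI[of _ _ _ "{0..h}"] simp: algebra_simps)
    have bd: "norm (?g (w + h *\<^sub>R a + t *\<^sub>R b) - ?g (w + t *\<^sub>R b) - h *\<^sub>R D a) \<le> e * h" if t: "t \<in> {0..h}" for t
    proof -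
      have 1: "norm (?g (w + s *\<^sub>R a + t *\<^sub>R b) - ?g w - D (s *\<^sub>R a + t *\<^sub>R b)) \<le> e' * norm (s *\<^sub>R a + t *\<^sub>R b)"
        if "s \<in> {0..h}" for s
        using d1(2)[of "w + s *\<^sub>R a + t *\<^sub>R b"] small[OF that t] by (simp add: add.assoc)
      \<comment> \<open>Both values of \<open>?g\<close> are expanded at \<open>w\<close>, the only
        point where \<open>?g\<close> is known to be differentiable; the second expansion is the
        case \<open>s = 0\<close>.\<close>
      have "?g (w + h *\<^sub>R a + t *\<^sub>R b) - ?g (w + t *\<^sub>R b) - h *\<^sub>R D a
        = (?g (w + h *\<^sub>R a + t *\<^sub>R b) - ?g w - D (h *\<^sub>R a + t *\<^sub>R b)) - (?g (w + 0 *\<^sub>R a + t *\<^sub>R b) - ?g w - D (0 *\<^sub>R a + t *\<^sub>R b))"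
        by (simp add: D.add D.scaleR)
      also have "norm \<dots> \<le> e' * norm (h *\<^sub>R a + t *\<^sub>R b) + e' * norm (0 *\<^sub>R a + t *\<^sub>R b)"
        using h by (intro order_trans[OF norm_triangle_ineq4] add_mono 1) auto
      also have "\<dots> = e' * (norm (h *\<^sub>R a + t *\<^sub>R b) + norm (t *\<^sub>R b))"
        by (simp add: algebra_simps)
      also have "\<dots> \<le> e' * (h * C)"
      proof (intro mult_left_mono)
        have "norm (h *\<^sub>R a + t *\<^sub>R b) \<le> h * norm a + t * norm b"
          using h t by (intro order_trans[OF norm_triangle_ineq]) auto
        moreover have "t * norm b \<le> h * norm b" using t by (intro mult_right_mono) auto
        ultimately show "norm (h *\<^sub>R a + t *\<^sub>R b) + norm (t *\<^sub>R b) \<le> h * C"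
          using t h by (simp add: C_def algebra_simps)
      qed (use e' in auto)
      also have "\<dots> = e * h" using C by (simp add: e'_def)
      finally show ?thesis .
    qed
    have "norm (p h - p 0) \<le> (e * h) * norm (h - 0)"
    proof (rule differentiable_bound[where S = "{0..h}", OF _ pd])
      show "onorm (\<lambda>y. y *\<^sub>R (?g (w + h *\<^sub>R a + t *\<^sub>R b) - ?g (w + t *\<^sub>R b) - h *\<^sub>R D a)) \<le> e * h"
        if "t \<in> {0..h}" for t
        using bd[OF that] by (intro onorm_le) (simp add: mult.commute mult_left_mono)
    qed (use h in auto)
    also have "p h - p 0 = f (w + h *\<^sub>R a + h *\<^sub>R b) - f (w + h *\<^sub>R a) - f (w + h *\<^sub>R b) + f w - h\<^sup>2 *\<^sub>R D a"
      by (simp add: p_def power2_eq_square algebra_simps)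
    finally show ?thesis using h by (simp add: power2_eq_square mult.assoc)
  qed
  ultimately show ?thesis by blast
qed

text \<open>The second difference does not change when \<open>a\<close> and \<open>b\<close> are
  exchanged, and both \<open>h^2 A b\<close> and \<open>h^2 B a\<close> approximate it up to
  o(h^2).\<close>

lemma symmetric_second_derivative:
  fixes f :: "'a::real_normed_vector \<Rightarrow> 'b::euclidean_space"
  assumes "open V" "w \<in> V" "\<And>u. u \<in> V \<Longrightarrow> f differentiable (at u)"
    and "((\<lambda>u. frechet_derivative f (at u) a) has_derivative A) (at w)"
    and "((\<lambda>u. frechet_derivative f (at u) b) has_derivative B) (at w)"
  shows "A b = B a"
proof -
  have "norm (A b - B a) \<le> e" if "e > 0" for e
  proof -
    from that have e: "e / 2 > 0" by simp
    obtain d1 where d1: "d1 > 0" "\<And>h. 0 < h \<Longrightarrow> h < d1 \<Longrightarrow>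
      norm (f (w + h *\<^sub>R a + h *\<^sub>R b) - f (w + h *\<^sub>R a) - f (w + h *\<^sub>R b) + f w - h\<^sup>2 *\<^sub>R B a) \<le> e / 2 * h\<^sup>2"
      using second_difference_bound[OF assms(1-3,5) e, of a] by blast
    obtain d2 where d2: "d2 > 0" "\<And>h. 0 < h \<Longrightarrow> h < d2 \<Longrightarrow>
      norm (f (w + h *\<^sub>R b + h *\<^sub>R a) - f (w + h *\<^sub>R b) - f (w + h *\<^sub>R a) + f w - h\<^sup>2 *\<^sub>R A b) \<le> e / 2 * h\<^sup>2"
      using second_difference_bound[OF assms(1-4) e, of b] by blast
    define h where "h = min d1 d2 / 2"
    have h: "0 < h" "h < d1" "h < d2" using d1 d2 by (auto simp: h_def)
    define x where "x = f (w + h *\<^sub>R a + h *\<^sub>R b) - f (w + h *\<^sub>R a) - f (w + h *\<^sub>R b) + f w"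
    have x: "x = f (w + h *\<^sub>R b + h *\<^sub>R a) - f (w + h *\<^sub>R b) - f (w + h *\<^sub>R a) + f w"
      by (simp add: x_def algebra_simps)
    have "h\<^sup>2 *\<^sub>R (A b - B a) = (x - h\<^sup>2 *\<^sub>R B a) - (x - h\<^sup>2 *\<^sub>R A b)"
      by (simp add: algebra_simps)
    also have "norm \<dots> \<le> e / 2 * h\<^sup>2 + e / 2 * h\<^sup>2"
      using d1(2)[OF h(1,2)] d2(2)[OF h(1,3)] unfolding x_def[symmetric] x[symmetric]
      by (rule order_trans[OF norm_triangle_ineq4 add_mono])
    finally show ?thesis using h by (simp add: mult.commute)
  qed
  then have "norm (A b - B a) \<le> 0" by (rule field_le_epsilon) simp
  then show ?thesis by simp
qed

section \<open>The Fubini--Study metric in affine charts\<close>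

lemma bilinear_hinner: "bilinear (hinner :: complex ^ 'n::finite \<Rightarrow> _)"
  unfolding bilinear_def hinner_def
  by (auto intro!: linearI simp: algebra_simps sum.distrib scaleR_sum_right)

lemma bounded_bilinear_hinner: "bounded_bilinear (hinner :: complex ^ 'n::finite \<Rightarrow> _)"
  using bilinear_hinner by (simp add: bilinear_conv_bounded_bilinear)

lemma bounded_bilinear_vector_scalar_mult:
  "bounded_bilinear ((*s) :: complex \<Rightarrow> complex ^ 'n::finite \<Rightarrow> _)"
  unfolding bilinear_conv_bounded_bilinear[symmetric] bilinear_def
  by (auto intro!: linearI simp: vec_eq_iff algebra_simps)

lemma bounded_linear_component: "bounded_linear (\<lambda>x::complex ^ 'n::finite. x $ k)"
  by (rule bounded_linear_vec_nth)

lemma hinner_simps: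
  "hinner (X + Y) Z = hinner X Z + hinner Y Z" "hinner X (Y + Z) = hinner X Y + hinner X Z"
  "hinner (X - Y) Z = hinner X Z - hinner Y Z" "hinner X (Y - Z) = hinner X Y - hinner X Z"
  "hinner (- X) Z = - hinner X Z" "hinner X (- Z) = - hinner X Z"
  "hinner (a *s X) Z = a * hinner X Z" "hinner X (a *s Z) = cnj a * hinner X Z"
  by (simp_all add: hinner_def algebra_simps sum.distrib sum_subtractf sum_negf sum_distrib_left)

lemma cnj_hinner: "cnj (hinner X Y) = hinner Y X"
  by (simp add: hinner_def mult.commute)

lemma hinner_self: "hinner X X = of_real ((norm X)\<^sup>2)"
  by (simp add: hinner_def norm_vec_def L2_set_def sum_nonneg flip: complex_norm_square)

lemma hinner_self_eq_0_iff: "hinner X X = 0 \<longleftrightarrow> X = 0"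
  by (simp add: hinner_self)

text \<open>The vector on the left is |F|^2 times the projection of \<open>X\<close> to the
  orthogonal complement of \<open>F\<close>. Thus the metric is the squared length of that
  projection divided by |F|^2, which yields positivity and the null space.\<close>

lemma norm_fubini_study:
  assumes "F \<noteq> 0"
  shows "(norm (hinner F F *s X - hinner X F *s F))\<^sup>2 = norm F ^ 6 * fubini_study F X X"
proof -
  let ?P = "hinner F F *s X - hinner X F *s F"
  have "of_real ((norm ?P)\<^sup>2) = hinner F F * (hinner F F * hinner X X - hinner X F * hinner F X)"
    by (subst hinner_self[symmetric]) (simp add: hinner_simps cnj_hinner algebra_simps)
  then have "(norm ?P)\<^sup>2 = Re (hinner F F * (hinner F F * hinner X X - hinner X F * hinner F X))"
    by (metis Re_complex_of_real)
  also have "\<dots> = norm F ^ 6 * fubini_study F X X"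
    using assms unfolding fubini_study_def
    by (simp add: hinner_self[of F] del: of_real_power) (simp add: field_simps flip: power_add)
  finally show ?thesis .
qed

lemma fubini_study_nonneg: "F \<noteq> 0 \<Longrightarrow> fubini_study F X X \<ge> 0"
  using norm_fubini_study[of F X]
  by (metis zero_le_mult_iff zero_le_power2 zero_less_norm_iff zero_less_power not_less)

text \<open>The metric degenerates only along \<open>F\<close>, and this direction is transversal to
  \<open>aff_dir k\<close>: the \<open>k\<close>-th component of the equation for null vectors
  forces \<open>hinner X F = 0\<close>.\<close>

lemma fubini_study_definite:
  assumes "F $ k = 1" "X \<in> aff_dir k" "fubini_study F X X = 0"
  shows "X = 0"
proof -
  have F: "F \<noteq> 0" using assms(1) by auto
  then have *: "hinner F F *s X = hinner X F *s F"
    using norm_fubini_study[OF F, of X] assms(3) by simp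
  then have "hinner X F = 0"
    using assms(1,2) by (auto simp: vec_eq_iff aff_dir_def dest!: spec[of _ k])
  with * show ?thesis using F by (simp add: hinner_self_eq_0_iff)
qed

lemma fubini_study_diff_left: "fubini_study F (X - Y) Z = fubini_study F X Z - fubini_study F Y Z"
  by (simp add: fubini_study_def hinner_simps algebra_simps diff_divide_distrib add_divide_distrib)

lemma fubini_study_add_left: "fubini_study F (X + Y) Z = fubini_study F X Z + fubini_study F Y Z"
  by (simp add: fubini_study_def hinner_simps algebra_simps diff_divide_distrib add_divide_distrib)

section \<open>The Levi-Civita connection of the metric\<close>

text \<open>Written with \<open>u = 1 / |F|^2\<close>, the derivative is polynomial in
  \<open>u\<close> and in Hermitian products, so that the Koszul formula turns into the polynomial
  identity \<open>koszul_identity\<close>.\<close>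

lemma fubini_study_has_derivative:
  assumes "F \<noteq> 0"
  defines "u \<equiv> 1 / (norm F)\<^sup>2"
  shows "((\<lambda>x. c * fubini_study x Y Z) has_derivative (\<lambda>X. c *
     (- 2 * Re (hinner X F) * Re (hinner Y Z) * u ^ 2
      - Re (hinner Y X * hinner F Z + hinner Y F * hinner X Z) * u ^ 2
      + 4 * Re (hinner X F) * Re (hinner Y F * hinner F Z) * u ^ 3))) (at F)"
proof -
  note d = bounded_bilinear.FDERIV[OF bounded_bilinear_hinner _ has_derivative_ident]
    bounded_bilinear.FDERIV[OF bounded_bilinear_hinner has_derivative_ident has_derivative_const]
    bounded_bilinear.FDERIV[OF bounded_bilinear_hinner has_derivative_const has_derivative_ident]
  let ?N = "\<lambda>x. Re (hinner x x)" and ?M = "\<lambda>x. Re (hinner x x * hinner Y Z - hinner Y x * hinner x Z)"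
  have u0: "u \<noteq> 0" using assms(1) by (simp add: u_def)
  have N: "?N F = 1 / u" "Im (hinner F F) = 0" "hinner F F = of_real (1 / u)"
    by (simp_all add: hinner_self u_def)
  have cr: "Re (hinner F X) = Re (hinner X F)" "Im (hinner F X) = - Im (hinner X F)" for X
    by (metis cnj.sel cnj_hinner)+
  have z: "hinner 0 X = 0" "hinner X 0 = 0" for X :: "complex ^ 'a"
    by (simp_all add: hinner_def)
  have dN: "(?N has_derivative (\<lambda>X. 2 * Re (hinner X F))) (at F)"
    by (rule has_derivative_eq_rhs, rule has_derivative_Re, rule d, rule has_derivative_ident)
      (simp add: cr)
  have "(?M has_derivative (\<lambda>X. Re ((hinner F X + hinner X F) * hinner Y Z
      - (hinner Y X * hinner F Z + hinner Y F * hinner X Z)))) (at F)"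
    by (rule has_derivative_eq_rhs, rule has_derivative_Re, rule has_derivative_diff,
        rule has_derivative_mult, (rule d has_derivative_const has_derivative_ident)+,
        rule has_derivative_mult, (rule d)+)
      (simp add: z algebra_simps)
  then have dM: "(?M has_derivative (\<lambda>X. 2 * Re (hinner X F) * Re (hinner Y Z)
      - Re (hinner Y X * hinner F Z + hinner Y F * hinner X Z))) (at F)"
    by (simp add: cr)
  have dI: "((\<lambda>x. inverse (?N x)) has_derivative (\<lambda>X. - (u * (2 * Re (hinner X F)) * u))) (at F)"
    using Deriv.has_derivative_inverse[OF _ dN] u0 by (simp add: N)
  have fs: "(\<lambda>x. c * fubini_study x Y Z) = (\<lambda>x. c * (?M x * inverse (?N x) * inverse (?N x)))"
    by (rule ext) (simp add: fubini_study_def hinner_self field_simps power2_eq_square power4_eq_xxxx)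
  have M: "?M F = Re (hinner Y Z) / u - Re (hinner Y F * hinner F Z)"
    unfolding N(3) by (simp add: N(1))
  show ?thesis unfolding fs
    by (rule has_derivative_eq_rhs[OF has_derivative_mult_right[OF has_derivative_mult[OF has_derivative_mult[OF dM dI] dI]]])
      (rule ext, unfold M, insert u0, simp add: N(1) field_simps power2_eq_square power3_eq_cube)
qed

text \<open>The Christoffel symbols of the Kaehler metric, extended complex bilinearly: they are
  \<open>h\<^sup>-\<^sup>1 \<partial>h\<close>.\<close>

definition fs_christoffel :: "complex ^ 'n::finite \<Rightarrow> complex ^ 'n \<Rightarrow> complex ^ 'n \<Rightarrow> complex ^ 'n" where
  "fs_christoffel F X Y = (- 1 / hinner F F) *s (hinner X F *s Y + hinner Y F *s X)"

text \<open>Here \<open>x\<close>, \<open>y\<close>, \<open>z\<close> stand for the products of \<open>X\<close>, \<open>Y\<close>, \<open>Z\<close> with \<open>F\<close>, further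
  \<open>p = \<langle>X, Y\<rangle>\<close>, \<open>q = \<langle>Y, Z\<rangle>\<close>, \<open>r = \<langle>X, Z\<rangle>\<close> and \<open>u = 1 / |F|\<^sup>2\<close>.\<close>

lemma koszul_identity:
  fixes x y z p q r :: complex and u :: real
  shows "Re (- (x * q + y * r) * u ^ 2 + 2 * x * y * cnj z * u ^ 3) = 1/2 * (
    (- 2 * Re x * Re q * u ^ 2 - Re (cnj p * cnj z + y * r) * u ^ 2 + 4 * Re x * Re (y * cnj z) * u ^ 3)
    + (- 2 * Re y * Re r * u ^ 2 - Re (p * cnj z + x * q) * u ^ 2 + 4 * Re y * Re (x * cnj z) * u ^ 3)
    - (- 2 * Re z * Re p * u ^ 2 - Re (r * cnj y + x * cnj q) * u ^ 2 + 4 * Re z * Re (x * cnj y) * u ^ 3))"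
  by (simp add: algebra_simps flip: of_real_power)

text \<open>\<open>christoffel\<close> is a definite description. Existence is the Koszul formula,
  checked here for every \<open>Z\<close>; uniqueness is definiteness of the metric on
  \<open>aff_dir k\<close>, applied to the difference of two candidates.\<close>

lemma christoffel_fubini_study:
  assumes "c > 0" "F $ k = 1" "X \<in> aff_dir k" "Y \<in> aff_dir k"
  shows "christoffel (aff_dir k) (\<lambda>F X Y. c * fubini_study F X Y) F X Y = fs_christoffel F X Y"
  unfolding christoffel_def
proof (rule the_equality)
  have F: "F \<noteq> 0" using assms(2) by auto
  define u where "u = 1 / (norm F)\<^sup>2"
  let ?h = "\<lambda>F X Y. c * fubini_study F X Y"
  let ?K = "\<lambda>Z. 1/2 * (frechet_derivative (\<lambda>y. ?h y Y Z) (at F) X +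
      frechet_derivative (\<lambda>y. ?h y X Z) (at F) Y - frechet_derivative (\<lambda>y. ?h y X Y) (at F) Z)"
  define D where "D X Y Z = - 2 * Re (hinner X F) * Re (hinner Y Z) * u ^ 2
      - Re (hinner Y X * hinner F Z + hinner Y F * hinner X Z) * u ^ 2
      + 4 * Re (hinner X F) * Re (hinner Y F * hinner F Z) * u ^ 3" for X Y Z
  have fd: "frechet_derivative (\<lambda>y. ?h y Y Z) (at F) X = c * D X Y Z" for X Y Z
    using frechet_derivative_at[OF fubini_study_has_derivative[OF F, of c Y Z]]
    by (simp add: u_def D_def fun_eq_iff)
  have koszul: "?h F (fs_christoffel F X Y) Z = ?K Z" for Z
  proof -
    have hF: "hinner F F = of_real (1 / u)" by (simp add: u_def hinner_self)
    have u0: "u \<noteq> 0" using F by (simp add: u_def)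
    have "fubini_study F (fs_christoffel F X Y) Z =
      Re (- (hinner X F * hinner Y Z + hinner Y F * hinner X Z) * u ^ 2
        + 2 * hinner X F * hinner Y F * cnj (hinner Z F) * u ^ 3)"
    proof -
      have "norm F ^ 4 = (1 / u) ^ 2" by (simp add: u_def flip: power_mult)
      moreover have "hinner F F * hinner (fs_christoffel F X Y) Z = - (hinner X F * hinner Y Z + hinner Y F * hinner X Z)"
        using F by (simp add: fs_christoffel_def hinner_simps hinner_self_eq_0_iff field_simps)
      moreover have "hinner (fs_christoffel F X Y) F = - 2 * hinner X F * hinner Y F * u"
        using u0 by (simp add: fs_christoffel_def hinner_simps hF field_simps)
      ultimately have "fubini_study F (fs_christoffel F X Y) Z =
         Re (- (hinner X F * hinner Y Z + hinner Y F * hinner X Z) - (- 2 * hinner X F * hinner Y F * u) * hinner F Z) / (1 / u) ^ 2"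
        by (simp add: fubini_study_def)
      also have "\<dots> = Re ((- (hinner X F * hinner Y Z + hinner Y F * hinner X Z) - (- 2 * hinner X F * hinner Y F * u) * hinner F Z) * of_real (u ^ 2))"
        by (simp add: power_one_over del: of_real_power)
      finally show ?thesis
        by (simp add: cnj_hinner algebra_simps power2_eq_square power3_eq_cube)
    qed
    also have "\<dots> = 1/2 * (D X Y Z + D Y X Z - D Z X Y)"
      using koszul_identity[of "hinner X F" "hinner Y Z" "hinner Y F" "hinner X Z" u "hinner Z F" "hinner X Y"]
      unfolding cnj_hinner D_def .
    finally have e: "fubini_study F (fs_christoffel F X Y) Z = 1/2 * (D X Y Z + D Y X Z - D Z X Y)" .
    show ?thesis unfolding fd e by (simp add: algebra_simps)
  qed
  show "fs_christoffel F X Y \<in> aff_dir k \<and> (\<forall>Z\<in>aff_dir k. ?h F (fs_christoffel F X Y) Z = ?K Z)"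
    using assms(3,4) koszul by (simp add: aff_dir_def fs_christoffel_def)
  fix \<Gamma> assume \<Gamma>: "\<Gamma> \<in> aff_dir k \<and> (\<forall>Z\<in>aff_dir k. ?h F \<Gamma> Z = ?K Z)"
  let ?D = "\<Gamma> - fs_christoffel F X Y"
  have D: "?D \<in> aff_dir k" using \<Gamma> assms(3,4) by (simp add: aff_dir_def fs_christoffel_def)
  have "c * fubini_study F ?D ?D = 0"
    using \<Gamma> koszul D by (simp add: fubini_study_diff_left right_diff_distrib)
  then show "\<Gamma> = fs_christoffel F X Y"
    using fubini_study_definite[OF assms(2) D] assms(1) by simp
qed

section \<open>Conformal harmonic maps into projective space\<close>

text \<open>\<open>fs_christoffel G\<close> is complex bilinear and symmetric. In the sum the terms
  in \<open>P, P\<close> and \<open>Q, Q\<close> carry X^2 + Y^2 and its conjugate, which vanish;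
  the mixed term carries 2 |X|^2 + 2 |Y|^2.\<close>

lemma fs_christoffel_sum:
  assumes "X\<^sup>2 + Y\<^sup>2 = 0" "norm X = norm Y"
  shows "fs_christoffel G (X *s P + cnj X *s Q) (X *s P + cnj X *s Q)
       + fs_christoffel G (Y *s P + cnj Y *s Q) (Y *s P + cnj Y *s Q)
       = of_real (4 * (norm X)\<^sup>2) *s fs_christoffel G P Q"
proof -
  have 1: "Y * Y = - (X * X)" "cnj Y * cnj Y = - (cnj X * cnj X)" "Y * cnj Y = X * cnj X"
  proof -
    show "Y * Y = - (X * X)" using assms(1) by (simp add: power2_eq_square eq_neg_iff_add_eq_0 add.commute)
    then show "cnj Y * cnj Y = - (cnj X * cnj X)" by (metis complex_cnj_minus complex_cnj_mult)
    show "Y * cnj Y = X * cnj X" using assms(2) by (simp flip: complex_norm_square)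
  qed
  have 2: "fs_christoffel G (X *s P + cnj X *s Q) (X *s P + cnj X *s Q) =
     (X * X) *s fs_christoffel G P P + (cnj X * cnj X) *s fs_christoffel G Q Q
     + (2 * (X * cnj X)) *s fs_christoffel G P Q" for X
    by (simp add: fs_christoffel_def hinner_simps vec_eq_iff algebra_simps add_divide_distrib diff_divide_distrib)
  show ?thesis
    unfolding 2 1 of_real_mult complex_norm_square by (simp add: vec_eq_iff algebra_simps)
qed

text \<open>Orthogonality makes \<open>X * cnj Y\<close> imaginary, so \<open>Y\<close> is
  \<open>\<i> * X\<close> or its negative. Multiplying X^2 + Y^2 by \<open>cnj Y\<close> avoids
  distinguishing the sign.\<close>

lemma orthonormal_complex:
  fixes X Y :: complex
  assumes "X \<bullet> Y = 0" "X \<bullet> X = Y \<bullet> Y"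
  shows "X\<^sup>2 + Y\<^sup>2 = 0" "norm X = norm Y"
proof -
  show n: "norm X = norm Y" using assms(2) by (simp add: norm_eq_sqrt_inner)
  have "Re (X * cnj Y) = 0" using assms(1) by (simp add: inner_complex_def)
  then have "cnj (X * cnj Y) = - (X * cnj Y)" by (simp add: complex_eq_iff)
  then have c: "cnj X * Y = - (X * cnj Y)" by simp
  have "Y * cnj Y = X * cnj X" using n by (simp flip: complex_norm_square)
  then have "cnj Y * (X\<^sup>2 + Y\<^sup>2) = X * (X * cnj Y + cnj X * Y)"
    by (simp add: power2_eq_square algebra_simps)
  then have "Y = 0 \<or> X\<^sup>2 + Y\<^sup>2 = 0" using c by simp
  then show "X\<^sup>2 + Y\<^sup>2 = 0" using n by auto
qed

lemma smooth_on_second_derivative: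
  assumes "w \<in> V" "smooth_on G V"
  shows "\<exists>H. \<forall>Y. ((\<lambda>u. frechet_derivative G (at u) Y) has_derivative H Y) (at w)"
  using smooth_on_imp_frechet_differentiable[OF assms(2,1)]
  unfolding differentiable_def by (rule choice[OF allI])

text \<open>The second derivative is a symmetric real bilinear form, and the trace of such a form
  over an orthogonal pair of common length |X| is |X|^2 times the trace over 1 and
  \<open>\<i>\<close>, the Laplacian.\<close>

lemma second_derivative_orthonormal_sum:
  fixes G :: "complex \<Rightarrow> 'b::euclidean_space"
  assumes "open V" "w \<in> V" "smooth_on G V" "X\<^sup>2 + Y\<^sup>2 = 0" "norm X = norm Y"
  defines "D2 \<equiv> \<lambda>A B. frechet_derivative (\<lambda>u. frechet_derivative G (at u) B) (at w) A"
  shows "D2 X X + D2 Y Y = (norm X)\<^sup>2 *\<^sub>R (D2 1 1 + D2 \<i> \<i>)" "D2 1 \<i> = D2 \<i> 1"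
proof -
  obtain H where H: "\<And>Y. ((\<lambda>u. frechet_derivative G (at u) Y) has_derivative H Y) (at w)"
    using smooth_on_second_derivative[OF assms(2,3)] by blast
  have D2: "D2 A B = H B A" for A B
    using frechet_derivative_at[OF H[of B]] by (simp add: D2_def)
  have lin: "linear (frechet_derivative G (at u))" if "u \<in> V" for u
    using smooth_on_imp_differentiable[OF assms(3) that] by (rule linear_frechet_derivative)
  have c: "A = Re A *\<^sub>R 1 + Im A *\<^sub>R \<i>" for A by (simp add: complex_eq_iff)
  \<comment> \<open>Linearity in the direction \<open>B\<close> differentiated first is inherited
    from linearity of the differential of \<open>G\<close> at all points near
    \<open>w\<close>.\<close>
  have "((\<lambda>u. frechet_derivative G (at u) B) has_derivative (\<lambda>A. Re B *\<^sub>R H 1 A + Im B *\<^sub>R H \<i> A)) (at w)" for B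
  proof (rule has_derivative_transform_within_open[OF _ assms(1,2)])
    show "((\<lambda>u. Re B *\<^sub>R frechet_derivative G (at u) 1 + Im B *\<^sub>R frechet_derivative G (at u) \<i>)
        has_derivative (\<lambda>A. Re B *\<^sub>R H 1 A + Im B *\<^sub>R H \<i> A)) (at w)"
      by (intro derivative_intros H)
    show "Re B *\<^sub>R frechet_derivative G (at u) 1 + Im B *\<^sub>R frechet_derivative G (at u) \<i> = frechet_derivative G (at u) B"
      if "u \<in> V" for u
      by (subst (3) c, simp only: linear_add[OF lin[OF that]] linear_cmul[OF lin[OF that]])
  qed
  then have H2: "H B A = Re B *\<^sub>R H 1 A + Im B *\<^sub>R H \<i> A" for A B
    using has_derivative_unique[OF H] by metis
  have "H 1 \<i> = H \<i> 1"
    by (rule symmetric_second_derivative[OF assms(1,2) smooth_on_imp_differentiable[OF assms(3)] H H])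
  then show "D2 1 \<i> = D2 \<i> 1" by (simp add: D2)
  have lH: "H B A = Re A *\<^sub>R H B 1 + Im A *\<^sub>R H B \<i>" for A B
    using has_derivative_linear[OF H[of B]] by (subst c[of A]) (simp only: linear_add linear_cmul)
  have hA: "H A A = Re A *\<^sub>R (Re A *\<^sub>R H 1 1 + Im A *\<^sub>R H 1 \<i>) + Im A *\<^sub>R (Re A *\<^sub>R H 1 \<i> + Im A *\<^sub>R H \<i> \<i>)" for A
    unfolding H2[of A A] lH[of 1 A] lH[of "\<i>" A] \<open>H 1 \<i> = H \<i> 1\<close> by (rule refl)
  have e: "H A A = (Re A)\<^sup>2 *\<^sub>R H 1 1 + (Re A * Im A + Re A * Im A) *\<^sub>R H 1 \<i> + (Im A)\<^sup>2 *\<^sub>R H \<i> \<i>" for A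
    unfolding hA[of A] by (simp only: scaleR_add_right scaleR_add_left scaleR_scaleR power2_eq_square mult.commute[of "Im A" "Re A"] add.assoc)
  have r: "(Re X)\<^sup>2 + (Re Y)\<^sup>2 = (norm X)\<^sup>2" "(Im X)\<^sup>2 + (Im Y)\<^sup>2 = (norm X)\<^sup>2"
    "(Re X * Im X + Re X * Im X) + (Re Y * Im Y + Re Y * Im Y) = 0"
  proof -
    have "Re (X\<^sup>2 + Y\<^sup>2) = 0" "Im (X\<^sup>2 + Y\<^sup>2) = 0" using assms(4) by simp_all
    moreover have "(norm X)\<^sup>2 = (norm Y)\<^sup>2" using assms(5) by simp
    ultimately show "(Re X)\<^sup>2 + (Re Y)\<^sup>2 = (norm X)\<^sup>2" "(Im X)\<^sup>2 + (Im Y)\<^sup>2 = (norm X)\<^sup>2"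
      "(Re X * Im X + Re X * Im X) + (Re Y * Im Y + Re Y * Im Y) = 0"
      by (simp_all add: cmod_power2 Re_power2 Im_power2 mult.commute mult.left_commute)
  qed
  have "H X X + H Y Y = ((Re X)\<^sup>2 + (Re Y)\<^sup>2) *\<^sub>R H 1 1
      + ((Re X * Im X + Re X * Im X) + (Re Y * Im Y + Re Y * Im Y)) *\<^sub>R H 1 \<i> + ((Im X)\<^sup>2 + (Im Y)\<^sup>2) *\<^sub>R H \<i> \<i>"
    unfolding e[of X] e[of Y] by (simp only: scaleR_add_left add_ac)
  then show "D2 X X + D2 Y Y = (norm X)\<^sup>2 *\<^sub>R (D2 1 1 + D2 \<i> \<i>)"
    by (simp only: r D2 scaleR_add_right scaleR_zero_left add_0_right)
qed

text \<open>\<open>G\<close> is the map in the affine chart \<open>k\<close> and \<open>F\<close> a lift of it; \<open>P\<close> is \<open>\<partial>\<^sub>z F\<close>.\<close>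

locale projective_curve =
  fixes J :: "complex ^ 'n::finite \<Rightarrow> complex ^ 'n"
    and F G P :: "complex \<Rightarrow> complex ^ 'n" and V :: "complex set" and k :: 'n and a :: real
  assumes J: "linear J" "\<And>c x. J (c *s x) = cnj c *s J x" "\<And>x. J (J x) = - x"
      "\<And>x. hinner (J x) x = 0"
    and V: "open V" and G: "smooth_on G V"
    and F_eq: "\<And>u. u \<in> V \<Longrightarrow> F u = F u $ k *s G u" and Fk: "\<And>u. u \<in> V \<Longrightarrow> F u $ k \<noteq> 0"
    and a: "a \<noteq> 0"
    and F': "\<And>u. u \<in> V \<Longrightarrow> (F has_derivative
      (\<lambda>v. v *s P u + cnj v *s ((of_real a * hinner (F u) (F u)) *s J (F u)))) (at u)"
    and PJ: "\<And>u. u \<in> V \<Longrightarrow> hinner (P u) (J (F u)) = 0"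
begin

section \<open>First derivatives and conformality\<close>

text \<open>The antiholomorphic derivative of the lift, as read off from \<open>F'\<close>.\<close>

definition E :: "complex \<Rightarrow> complex ^ 'n" where
  "E u = (of_real a * hinner (F u) (F u)) *s J (F u)"

text \<open>\<open>Gz\<close> and \<open>Gzbar\<close> are the Wirtinger derivatives of
  \<open>G\<close>: differentiating \<open>F = F_k G\<close> gives
  \<open>dG = (dF - dF_k G) / F_k\<close>.\<close>

definition Gz :: "complex \<Rightarrow> complex ^ 'n" where
  "Gz u = (1 / F u $ k) *s (P u - P u $ k *s G u)"

definition Gzbar :: "complex \<Rightarrow> complex ^ 'n" where
  "Gzbar u = (1 / F u $ k) *s (E u - E u $ k *s G u)"

lemma F_has_derivative: "u \<in> V \<Longrightarrow> (F has_derivative (\<lambda>v. v *s P u + cnj v *s E u)) (at u)"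
  using F' by (simp add: E_def)

lemma G_k: assumes "u \<in> V" shows "G u $ k = 1"
proof -
  have "F u $ k = F u $ k * G u $ k" by (subst F_eq[OF assms]) simp
  then show ?thesis using Fk[OF assms] by simp
qed

lemma F_nz: "u \<in> V \<Longrightarrow> F u \<noteq> 0"
  by (metis Fk zero_index)

lemma G_nz: "u \<in> V \<Longrightarrow> G u \<noteq> 0"
  by (metis G_k zero_index zero_neq_one)

lemma G_derivative:
  assumes "u \<in> V"
  shows "frechet_derivative G (at u) = (\<lambda>v. v *s Gz u + cnj v *s Gzbar u)"
proof -
  have D: "(G has_derivative frechet_derivative G (at u)) (at u)"
    using smooth_on_imp_differentiable[OF G assms] frechet_derivative_works by blast
  have Fk': "((\<lambda>u. F u $ k) has_derivative (\<lambda>v. (v *s P u + cnj v *s E u) $ k)) (at u)"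
    by (rule bounded_linear.has_derivative[OF bounded_linear_component F_has_derivative[OF assms]])
  have "(F has_derivative (\<lambda>v. F u $ k *s frechet_derivative G (at u) v + (v *s P u + cnj v *s E u) $ k *s G u)) (at u)"
    by (rule has_derivative_transform_within_open[OF
          bounded_bilinear.FDERIV[OF bounded_bilinear_vector_scalar_mult Fk' D] V assms])
      (rule F_eq[symmetric])
  then have "(\<lambda>v. F u $ k *s frechet_derivative G (at u) v + (v *s P u + cnj v *s E u) $ k *s G u)
      = (\<lambda>v. v *s P u + cnj v *s E u)"
    using F_has_derivative[OF assms] by (rule has_derivative_unique)
  from fun_cong[OF this] have *: "F u $ k *s frechet_derivative G (at u) v =
      v *s P u + cnj v *s E u - (v *s P u + cnj v *s E u) $ k *s G u" for v
    unfolding eq_diff_eq .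
  have "frechet_derivative G (at u) v = (1 / F u $ k) *s (F u $ k *s frechet_derivative G (at u) v)" for v
    using Fk[OF assms] by simp
  then show ?thesis
    unfolding * fun_eq_iff Gz_def Gzbar_def using Fk[OF assms] by (simp add: vec_eq_iff field_simps)
qed

lemma J_nz: "x \<noteq> 0 \<Longrightarrow> J x \<noteq> 0"
  by (metis J(1) J(3) linear_0 neg_equal_0_iff_equal)

lemma hinner_EF: "u \<in> V \<Longrightarrow> hinner (E u) (F u) = 0" and hinner_PE: "u \<in> V \<Longrightarrow> hinner (P u) (E u) = 0"
  by (simp_all add: E_def hinner_simps J(4) PJ)

lemma hinner_EG: assumes "u \<in> V" shows "hinner (E u) (G u) = 0"
proof -
  have "hinner (E u) (F u $ k *s G u) = 0"
    using hinner_EF[OF assms] by (simp only: F_eq[OF assms, symmetric])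
  then show ?thesis using Fk[OF assms] by (simp add: hinner_simps)
qed

lemma hinner_GE: assumes "u \<in> V" shows "hinner (G u) (E u) = 0"
  using hinner_EG[OF assms] by (metis cnj_hinner complex_cnj_zero)

lemma hinner_GG: assumes "u \<in> V" shows "hinner (G u) (G u) \<noteq> 0"
  using G_nz[OF assms] by (simp add: hinner_self_eq_0_iff)

lemma tangent_in_aff_dir:
  assumes "u \<in> V" shows "v *s Gz u + v' *s Gzbar u \<in> aff_dir k" "Gz u \<in> aff_dir k" "Gzbar u \<in> aff_dir k"
  using Fk[OF assms] G_k[OF assms] by (simp_all add: aff_dir_def Gz_def Gzbar_def)

text \<open>The Hermitian form \<open>H\<close> below annihilates \<open>G w\<close> in either slot,
  so \<open>H (Gz w) (Gzbar w)\<close> reduces to products of \<open>P w\<close>, \<open>E w\<close>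
  and \<open>G w\<close>. It vanishes because \<open>E w\<close> is orthogonal to \<open>G w\<close>
  and to \<open>P w\<close>; without the mixed terms only multiples of \<open>X * cnj Y\<close> and
  its conjugate remain.\<close>

lemma conformal:
  assumes "w \<in> V"
  shows "fubini_study (G w) (X *s Gz w + cnj X *s Gzbar w) (Y *s Gz w + cnj Y *s Gzbar w)
    = (fubini_study (G w) (Gz w) (Gz w) + fubini_study (G w) (Gzbar w) (Gzbar w)) * (X \<bullet> Y)"
proof -
  define H where "H X Y = hinner (G w) (G w) * hinner X Y - hinner X (G w) * hinner (G w) Y" for X Y
  have H0: "H (Gz w) (Gzbar w) = 0"
    using hinner_EG[OF assms] hinner_GE[OF assms] hinner_PE[OF assms]
    by (simp add: H_def Gz_def Gzbar_def hinner_simps algebra_simps)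
  have HC: "cnj (H X Y) = H Y X" for X Y by (simp add: H_def cnj_hinner mult.commute)
  then have H1: "H (Gzbar w) (Gz w) = 0" using H0 by (metis complex_cnj_zero)
  have I: "Im (H X X) = 0" for X using HC[of X X] by (metis Reals_cnj_iff complex_is_Real_iff)
  have "H (X *s Gz w + cnj X *s Gzbar w) (Y *s Gz w + cnj Y *s Gzbar w) =
     X * cnj Y * H (Gz w) (Gz w) + X * Y * H (Gz w) (Gzbar w) + cnj X * cnj Y * H (Gzbar w) (Gz w) + cnj X * Y * H (Gzbar w) (Gzbar w)"
    by (simp add: H_def hinner_simps algebra_simps)
  then have "Re (H (X *s Gz w + cnj X *s Gzbar w) (Y *s Gz w + cnj Y *s Gzbar w)) =
    (Re (H (Gz w) (Gz w)) + Re (H (Gzbar w) (Gzbar w))) * (X \<bullet> Y)"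
    by (simp add: H0 H1 I inner_complex_def algebra_simps)
  then show ?thesis unfolding fubini_study_def H_def[symmetric] by (simp add: add_divide_distrib algebra_simps)
qed

text \<open>If \<open>Gzbar w\<close> were zero, \<open>E w\<close> would be a multiple of
  \<open>G w\<close>; being orthogonal to \<open>G w\<close> it would vanish, although
  \<open>J (F w)\<close> does not.\<close>

lemma conformal_factor_pos:
  assumes "w \<in> V"
  shows "fubini_study (G w) (Gz w) (Gz w) + fubini_study (G w) (Gzbar w) (Gzbar w) > 0"
proof -
  have "Gzbar w \<noteq> 0"
  proof
    assume "Gzbar w = 0"
    moreover have "1 / F w $ k \<noteq> 0" using Fk[OF assms] by simp
    ultimately have "E w - E w $ k *s G w = 0"
      unfolding Gzbar_def vector_mul_eq_0 by blast
    then have "E w = E w $ k *s G w" by (rule iffD2[OF eq_iff_diff_eq_0])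
    then have "hinner (E w) (E w) = 0"
      using hinner_GE[OF assms] by (metis hinner_simps(7) mult_zero_right)
    then show False
      using a F_nz[OF assms] J_nz[OF F_nz[OF assms]] hinner_self_eq_0_iff[of "F w"]
      by (simp add: hinner_self_eq_0_iff E_def)
  qed
  then have "fubini_study (G w) (Gzbar w) (Gzbar w) \<noteq> 0"
    using fubini_study_definite[OF G_k tangent_in_aff_dir(3)] assms by blast
  then show ?thesis
    using fubini_study_nonneg[OF G_nz[OF assms]] by (smt (verit))
qed

section \<open>Harmonicity and minimality\<close>

text \<open>The left side is 4 times the mixed second Wirtinger derivative of \<open>G\<close>. It
  is found by applying the holomorphic derivative to \<open>F_k Gzbar = E - E_k G\<close>.\<close>

lemma second_order:
  assumes w: "w \<in> V"
  defines "D2 \<equiv> \<lambda>A B. frechet_derivative (\<lambda>u. frechet_derivative G (at u) B) (at w) A"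
  shows "D2 1 1 + D2 \<i> \<i> = 4 *s ((hinner (P w) (F w) / hinner (F w) (F w) - P w $ k / F w $ k) *s Gzbar w
    - (E w $ k / F w $ k) *s Gz w)"
proof -
  note sm = bounded_bilinear.FDERIV[OF bounded_bilinear_vector_scalar_mult]
  note comp = bounded_linear.has_derivative[OF bounded_linear_component]
  define n where "n = hinner (F w) (F w)"
  have n: "cnj n = n" "n \<noteq> 0"
    using F_nz[OF w] by (simp_all add: n_def cnj_hinner hinner_self_eq_0_iff)
  obtain H where H: "\<And>Y. ((\<lambda>u. frechet_derivative G (at u) Y) has_derivative H Y) (at w)"
    using smooth_on_second_derivative[OF w G] by blast
  have D2: "D2 A B = H B A" for A B
    using frechet_derivative_at[OF H[of B]] by (simp add: D2_def)
  have sym: "H 1 \<i> = H \<i> 1"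
    using second_derivative_orthonormal_sum(2)[OF V w G, of 1 "\<i>"] unfolding D2[unfolded D2_def] by simp
  define K where "K v = (1 / 2) *s (H 1 v + \<i> *s H \<i> v)" for v
  have "((\<lambda>u. (1 / 2) *s (frechet_derivative G (at u) 1 + \<i> *s frechet_derivative G (at u) \<i>)) has_derivative
      (\<lambda>v. (1 / 2) *s (H 1 v + \<i> *s H \<i> v))) (at w)"
    by (intro has_derivative_add H
        bounded_linear.has_derivative[OF bounded_bilinear.bounded_linear_right[OF bounded_bilinear_vector_scalar_mult]])
  then have Gb': "(Gzbar has_derivative K) (at w)"
    unfolding K_def[abs_def]
  proof (rule has_derivative_transform_within_open[OF _ V w])
    show "(1 / 2) *s (frechet_derivative G (at u) 1 + \<i> *s frechet_derivative G (at u) \<i>) = Gzbar u" if "u \<in> V" for u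
      unfolding G_derivative[OF that] by (simp add: vec_eq_iff algebra_simps)
  qed
  have G': "(G has_derivative (\<lambda>v. v *s Gz w + cnj v *s Gzbar w)) (at w)"
    using smooth_on_imp_differentiable[OF G w] by (simp add: frechet_derivative_works G_derivative[OF w])
  \<comment> \<open>\<open>A\<close> and \<open>B\<close> are the holomorphic and antiholomorphic
    derivatives of \<open>E\<close>. Since \<open>J\<close> is antilinear, the holomorphic
    derivative of \<open>J F\<close> is \<open>J E = - a n F\<close>; that of |F|^2 is
    \<open>hinner P F\<close>, as \<open>F\<close> and \<open>E\<close> are orthogonal.\<close>
  define A where "A = (of_real a * hinner (P w) (F w)) *s J (F w) - (of_real a * n)\<^sup>2 *s F w"
  define B where "B = (of_real a * n) *s J (P w) + (of_real a * hinner (F w) (P w)) *s J (F w)"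
  have E': "(E has_derivative (\<lambda>v. v *s A + cnj v *s B)) (at w)"
  proof -
    note F' = F_has_derivative[OF w]
    have "((\<lambda>u. (of_real a * hinner (F u) (F u)) *s J (F u)) has_derivative
      (\<lambda>v. (of_real a * hinner (F w) (F w)) *s J (v *s P w + cnj v *s E w) +
         (of_real a * (hinner (F w) (v *s P w + cnj v *s E w) + hinner (v *s P w + cnj v *s E w) (F w))) *s J (F w))) (at w)"
      by (intro sm has_derivative_mult_right bounded_bilinear.FDERIV[OF bounded_bilinear_hinner]
          bounded_linear.has_derivative[OF linear_conv_bounded_linear[THEN iffD1, OF J(1)]] F')
    moreover have "J (E w) = - ((of_real a * n) *s F w)"
      by (simp add: E_def J n flip: n_def)
    moreover have "hinner (F w) (E w) = 0"
      using hinner_EF[OF w] by (metis cnj_hinner complex_cnj_zero)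
    ultimately show ?thesis
      unfolding E_def[abs_def, symmetric]
      by (elim has_derivative_eq_rhs)
        (simp add: fun_eq_iff vec_eq_iff linear_add[OF J(1)] J(2) hinner_simps hinner_EF[OF w] A_def B_def
          n_def[symmetric] power2_eq_square algebra_simps)
  qed
  have "(\<lambda>v. F w $ k *s K v + (v *s P w + cnj v *s E w) $ k *s Gzbar w) =
     (\<lambda>v. (v *s A + cnj v *s B) - (E w $ k *s (v *s Gz w + cnj v *s Gzbar w) + (v *s A + cnj v *s B) $ k *s G w))"
  proof (rule has_derivative_unique)
    show "((\<lambda>u. F u $ k *s Gzbar u) has_derivative
        (\<lambda>v. F w $ k *s K v + (v *s P w + cnj v *s E w) $ k *s Gzbar w)) (at w)"
      by (intro sm comp F_has_derivative[OF w] Gb')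
    have "((\<lambda>u. E u - E u $ k *s G u) has_derivative
      (\<lambda>v. (v *s A + cnj v *s B) - (E w $ k *s (v *s Gz w + cnj v *s Gzbar w) + (v *s A + cnj v *s B) $ k *s G w))) (at w)"
      by (intro has_derivative_diff sm comp E' G')
    then show "((\<lambda>u. F u $ k *s Gzbar u) has_derivative
      (\<lambda>v. (v *s A + cnj v *s B) - (E w $ k *s (v *s Gz w + cnj v *s Gzbar w) + (v *s A + cnj v *s B) $ k *s G w))) (at w)"
      by (rule has_derivative_transform_within_open[OF _ V w]) (simp add: Gzbar_def Fk)
  qed
  then have eq: "F w $ k * K v $ j + (v * P w $ k + cnj v * E w $ k) * Gzbar w $ j =
     v * A $ j + cnj v * B $ j - (E w $ k * (v * Gz w $ j + cnj v * Gzbar w $ j) + (v * A $ k + cnj v * B $ k) * G w $ j)" for v j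
    by (metis (no_types, lifting) vector_add_component vector_minus_component vector_smult_component)
  \<comment> \<open>The summand of \<open>A\<close> along \<open>F w\<close> is a multiple of
    \<open>G w\<close> and drops out; the other is a multiple of \<open>E w\<close>, and
    \<open>E - E_k G\<close> is \<open>F_k Gzbar\<close>.\<close>
  have A: "A $ j - A $ k * G w $ j = hinner (P w) (F w) / n * (F w $ k * Gzbar w $ j)" for j
  proof -
    have "F w $ j = F w $ k * G w $ j" by (subst F_eq[OF w]) simp
    then show ?thesis
      using n(2) Fk[OF w] by (simp add: A_def Gzbar_def E_def flip: n_def) (simp add: field_simps)
  qed
  have eq': "F w $ k * K v $ j = v * A $ j + cnj v * B $ j
     - (E w $ k * (v * Gz w $ j + cnj v * Gzbar w $ j) + (v * A $ k + cnj v * B $ k) * G w $ j)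
     - (v * P w $ k + cnj v * E w $ k) * Gzbar w $ j" for v j
    using eq[of v j] by (simp only: eq_diff_eq)
  \<comment> \<open>Combining the values at 1 and \<open>\<i>\<close> extracts twice the coefficient
    of \<open>v\<close> and removes that of \<open>cnj v\<close>, hence all of
    \<open>B\<close>.\<close>
  have "F w $ k * K 1 $ j - \<i> * (F w $ k * K \<i> $ j) = 2 * (A $ j - A $ k * G w $ j - E w $ k * Gz w $ j - P w $ k * Gzbar w $ j)" for j
    unfolding eq' by (simp add: algebra_simps)
  then have "F w $ k * K 1 $ j - \<i> * (F w $ k * K \<i> $ j) =
     2 * (hinner (P w) (F w) / n * (F w $ k * Gzbar w $ j) - E w $ k * Gz w $ j - P w $ k * Gzbar w $ j)" for j
    unfolding A .
  then have "2 / F w $ k * (F w $ k * K 1 $ j - \<i> * (F w $ k * K \<i> $ j)) = 2 / F w $ k *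
     (2 * (hinner (P w) (F w) / n * (F w $ k * Gzbar w $ j) - E w $ k * Gz w $ j - P w $ k * Gzbar w $ j))" for j
    by simp
  then have "2 * (K 1 $ j - \<i> * K \<i> $ j) =
     4 * ((hinner (P w) (F w) / n - P w $ k / F w $ k) * Gzbar w $ j - (E w $ k / F w $ k) * Gz w $ j)" for j
    using Fk[OF w] by (simp add: right_diff_distrib left_diff_distrib mult.left_commute)
  moreover have "2 * (K 1 $ j - \<i> * K \<i> $ j) = H 1 1 $ j + H \<i> \<i> $ j" for j
    using sym by (simp add: K_def algebra_simps)
  ultimately have "H 1 1 $ j + H \<i> \<i> $ j =
     4 * ((hinner (P w) (F w) / n - P w $ k / F w $ k) * Gzbar w $ j - (E w $ k / F w $ k) * Gz w $ j)" for j
    by metis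
  then show ?thesis
    unfolding D2 n_def[symmetric] vec_eq_iff vector_add_component vector_smult_component vector_minus_component
    by blast
qed

text \<open>By \<open>second_order\<close> this is the mixed second derivative of \<open>G\<close>
  plus the Christoffel term, a quarter of the tension field for the flat metric. The coefficients of
  the Christoffel term are \<open>hinner (Gz w) (G w)\<close> and
  \<open>hinner (Gzbar w) (G w)\<close> over |G|^2; rewritten through \<open>F\<close> they cancel
  the others, as \<open>E w\<close> is orthogonal to \<open>G w\<close>.\<close>

lemma harmonic:
  assumes w: "w \<in> V"
  shows "(hinner (P w) (F w) / hinner (F w) (F w) - P w $ k / F w $ k) *s Gzbar w
    - (E w $ k / F w $ k) *s Gz w + fs_christoffel (G w) (Gz w) (Gzbar w) = 0"
proof -
  let ?f = "F w $ k" and ?g = "hinner (G w) (G w)"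
  note nz = Fk[OF w] hinner_GG[OF w]
  have PG: "hinner (Gz w) (G w) = (hinner (P w) (G w) - P w $ k * ?g) / ?f"
    by (simp add: Gz_def hinner_simps diff_divide_distrib)
  have HF: "hinner X (F w) = cnj ?f * hinner X (G w)" for X
    using arg_cong[OF F_eq[OF w], of "hinner X"] unfolding hinner_simps(8) .
  have FF: "hinner (F w) (F w) = ?f * cnj ?f * ?g"
    using arg_cong[OF F_eq[OF w], of "\<lambda>X. hinner X (F w)"] unfolding hinner_simps(7) HF by simp
  have "cnj ?f \<noteq> 0" using nz by simp
  then have 1: "hinner (Gz w) (G w) = ?g * (hinner (P w) (F w) / hinner (F w) (F w) - P w $ k / ?f)"
    unfolding PG FF unfolding HF using nz by (simp add: field_simps)
  have 2: "hinner (Gzbar w) (G w) = - ?g * (E w $ k / ?f)"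
    using nz hinner_EG[OF w] by (simp add: Gzbar_def hinner_simps)
  show ?thesis
    unfolding fs_christoffel_def 1 2 using nz by (simp add: vec_eq_iff field_simps)
qed

text \<open>By conformality a pair orthonormal for the induced metric is orthogonal and of equal
  length in the plane. The trace of the covariant derivative over it is a multiple of the expression
  in \<open>harmonic\<close>, so it vanishes already before pairing with a normal vector.\<close>

lemma minimal:
  assumes w: "w \<in> V" and c: "c > 0"
  shows "minimal_at (aff_dir k) (\<lambda>F X Y. c * fubini_study F X Y) G w"
  unfolding minimal_at_def
proof (intro allI impI, elim conjE)
  let ?h = "\<lambda>F X Y. c * fubini_study F X Y"
  fix \<nu> X Y
  assume *: "pullback_metric ?h G w X X = 1" "pullback_metric ?h G w Y Y = 1" "pullback_metric ?h G w X Y = 0"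
  define \<alpha> where "\<alpha> = c * (fubini_study (G w) (Gz w) (Gz w) + fubini_study (G w) (Gzbar w) (Gzbar w))"
  have pm: "pullback_metric ?h G w X Y = \<alpha> * (X \<bullet> Y)" for X Y
    unfolding pullback_metric_def G_derivative[OF w] conformal[OF w] by (simp add: \<alpha>_def)
  have \<alpha>: "\<alpha> > 0" using c conformal_factor_pos[OF w] by (simp add: \<alpha>_def)
  then have "X \<bullet> Y = 0" "X \<bullet> X = Y \<bullet> Y"
    using *(3) trans[OF *(1) *(2)[symmetric]] unfolding pm by auto
  note XY = orthonormal_complex[OF this]
  let ?C = "cov_deriv_along (aff_dir k) ?h G w"
  let ?D2 = "\<lambda>A B. frechet_derivative (\<lambda>u. frechet_derivative G (at u) B) (at w) A"
  let ?T = "(hinner (P w) (F w) / hinner (F w) (F w) - P w $ k / F w $ k) *s Gzbar w - (E w $ k / F w $ k) *s Gz w"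
  have C: "?C X X = ?D2 X X + fs_christoffel (G w) (X *s Gz w + cnj X *s Gzbar w) (X *s Gz w + cnj X *s Gzbar w)" for X
    unfolding cov_deriv_along_def G_derivative[OF w]
    by (simp only: christoffel_fubini_study[OF c G_k[OF w] tangent_in_aff_dir(1)[OF w] tangent_in_aff_dir(1)[OF w]])
  have scale: "r *\<^sub>R (4 *s S) + of_real (4 * r) *s T = of_real (4 * r) *s (S + T)" for r and S T :: "complex ^ 'n"
    by (simp add: vec_eq_iff) (simp add: scaleR_conv_of_real algebra_simps)
  have "?C X X + ?C Y Y = (?D2 X X + ?D2 Y Y) + of_real (4 * (norm X)\<^sup>2) *s fs_christoffel (G w) (Gz w) (Gzbar w)"
    unfolding C fs_christoffel_sum[OF XY, symmetric] by simp
  also have "\<dots> = of_real (4 * (norm X)\<^sup>2) *s (?T + fs_christoffel (G w) (Gz w) (Gzbar w))"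
    unfolding second_derivative_orthonormal_sum(1)[OF V w G XY] second_order[OF w]
    by (rule scale)
  also have "\<dots> = 0" unfolding harmonic[OF w] by simp
  finally have "?C X X + ?C Y Y = 0" .
  then have "fubini_study (G w) (?C X X) \<nu> + fubini_study (G w) (?C Y Y) \<nu> = fubini_study (G w) 0 \<nu>"
    by (simp flip: fubini_study_add_left)
  also have "\<dots> = 0" using fubini_study_diff_left[of "G w" 0 0 \<nu>] by simp
  finally show "second_fundamental_form (aff_dir k) ?h G w \<nu> X X + second_fundamental_form (aff_dir k) ?h G w \<nu> Y Y = 0"
    unfolding second_fundamental_form_def by (simp flip: distrib_left)
qed

lemma conformal_immersion:
  assumes w: "w \<in> V" and c: "c > 0" and r: "r > 0" and g: "\<And>X Y. g w X Y = r * (X \<bullet> Y)"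
  shows "conformal_immersion_at g (\<lambda>F X Y. c * fubini_study F X Y) G w"
  unfolding conformal_immersion_at_def pullback_metric_def G_derivative[OF w] conformal[OF w] g
proof (intro exI conjI allI)
  let ?A = "fubini_study (G w) (Gz w) (Gz w) + fubini_study (G w) (Gzbar w) (Gzbar w)"
  show "0 < c * ?A / r" using c r conformal_factor_pos[OF w] by simp
  show "c * (?A * (X \<bullet> Y)) = c * ?A / r * (r * (X \<bullet> Y))" for X Y using r by simp
qed

end

section \<open>Spinors in a local frame\<close>

lemma has_derivative_wirtinger:
  assumes "f differentiable (at w)"
  shows "(f has_derivative (\<lambda>v. v * d_z f w + cnj v * d_zbar f w)) (at w)"
proof -
  let ?D = "frechet_derivative f (at w)"
  have D: "(f has_derivative ?D) (at w)" using assms frechet_derivative_works by blast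
  note lin = has_derivative_linear[OF D]
  have D_v: "?D v = Re v *\<^sub>R ?D 1 + Im v *\<^sub>R ?D \<i>" for v
  proof -
    have "v = Re v *\<^sub>R 1 + Im v *\<^sub>R \<i>" by (simp add: complex_eq_iff)
    then show ?thesis by (metis linear_add[OF lin] linear_cmul[OF lin])
  qed
  have "?D v = v * d_z f w + cnj v * d_zbar f w" for v
    unfolding d_z_def d_zbar_def by (subst D_v) (simp add: complex_eq_iff field_simps)
  then have "?D = (\<lambda>v. v * d_z f w + cnj v * d_zbar f w)" by (rule ext)
  with D show ?thesis by simp
qed

lemma d_z_eqI:
  assumes "(f has_derivative (\<lambda>v. v * p + cnj v * q)) (at w)"
  shows "d_z f w = p" "d_zbar f w = q"
  unfolding d_z_def d_zbar_def frechet_derivative_at[OF assms, symmetric]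
  by (simp_all add: algebra_simps)

lemma d_z_cnj:
  assumes "f differentiable (at w)"
  shows "d_z (\<lambda>u. cnj (f u)) w = cnj (d_zbar f w)" "d_zbar (\<lambda>u. cnj (f u)) w = cnj (d_z f w)"
proof -
  have "((\<lambda>u. cnj (f u)) has_derivative (\<lambda>v. v * cnj (d_zbar f w) + cnj v * cnj (d_z f w))) (at w)"
    using has_derivative_cnj[OF has_derivative_wirtinger[OF assms]] by (simp add: add.commute)
  from d_z_eqI[OF this] show "d_z (\<lambda>u. cnj (f u)) w = cnj (d_zbar f w)" "d_zbar (\<lambda>u. cnj (f u)) w = cnj (d_z f w)"
    by auto
qed

lemma sum_UNIV_prod_bool:
  "(\<Sum>x\<in>UNIV. g (x :: 'm::finite \<times> bool)) = (\<Sum>j\<in>UNIV. g (j, True) + g (j, False))"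
proof -
  have "(\<Sum>x\<in>UNIV. g x) = (\<Sum>(j, b)\<in>UNIV \<times> UNIV. g (j, b))" by simp
  also have "\<dots> = (\<Sum>j\<in>UNIV. \<Sum>b\<in>UNIV. g (j, b))" by (rule sum.cartesian_product[symmetric])
  finally show ?thesis by (simp add: UNIV_bool add.commute)
qed

section \<open>The quaternionic structure and the energy-momentum tensor\<close>

definition quat_J :: "complex ^ ('m::finite \<times> bool) \<Rightarrow> complex ^ ('m \<times> bool)" where
  "quat_J F = (\<chi> x. if snd x then - cnj (F $ (fst x, False)) else cnj (F $ (fst x, True)))"

lemma quat_J_simps:
  "quat_J F $ (j, True) = - cnj (F $ (j, False))" "quat_J F $ (j, False) = cnj (F $ (j, True))"
  by (simp_all add: quat_J_def)

lemma vec_prod_bool_eqI: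
  fixes F G :: "'b ^ ('m::finite \<times> bool)"
  assumes "\<And>j. F $ (j, True) = G $ (j, True)" "\<And>j. F $ (j, False) = G $ (j, False)"
  shows "F = G"
  unfolding vec_eq_iff by (metis (full_types) assms prod.exhaust)

lemma quat_J:
  "linear quat_J" "quat_J (c *s F) = cnj c *s quat_J F" "quat_J (quat_J F) = - F"
  "hinner (quat_J F) F = 0"
  by (auto intro!: linearI vec_prod_bool_eqI simp: quat_J_simps hinner_def sum_UNIV_prod_bool)

text \<open>The |X|^2 part comes from the antiholomorphic derivatives, replaced by means of the
  Dirac equation; the X^2 part comes from the holomorphic ones. The connection form \<open>L\<close>
  contributes \<open>a B L\<close> from one half of the spinor and \<open>- a B L\<close> from the
  other, after conjugating the first inside the real part.\<close>

lemma energy_momentum_diagonal: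
  fixes f :: "complex \<Rightarrow> complex \<times> complex" and N :: "complex \<Rightarrow> real" and w :: complex
  defines "a \<equiv> fst \<circ> f" and "B \<equiv> cnj \<circ> snd \<circ> f"
  assumes N: "N w \<noteq> 0"
    and a: "d_zbar a w = - of_real lam * cnj (B w) / (2 * of_real (N w))"
    and B: "d_zbar B w = of_real lam * cnj (a w) / (2 * of_real (N w))"
  shows "energy_momentum N f w X X = lam / (2 * N w) * (norm X)\<^sup>2 * Re (a w * cnj (a w) + B w * cnj (B w))
     + Re (X\<^sup>2 * (a w * d_z B w - B w * d_z a w))"
proof -
  define L where "L = d_z (\<lambda>u. of_real (ln (N u))) w"
  define t where "t = lam / (2 * N w)"
  have f: "fst (f w) = a w" "snd (f w) = cnj (B w)" by (simp_all add: a_def B_def)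
  have a': "d_zbar a w = - of_real t * cnj (B w)" and B': "d_zbar B w = of_real t * cnj (a w)"
    unfolding a B t_def by simp_all
  have "energy_momentum N f w X X = Re (of_real (N w) *
     ((cnj X * cnj (X * (d_z B w + B w * L) + cnj X * d_zbar B w) / of_real (N w)) * cnj (a w)
      + (- X * (X * (d_z a w + a w * L) + cnj X * d_zbar a w) / of_real (N w)) * B w))"
    unfolding energy_momentum_def spinor_herm_def clifford_mult_def clifford_connection_def
      chern_connection_def conj_vec_def complexify_def L_def[symmetric] f fst_conv snd_conv
      a_def[symmetric] B_def[symmetric]
    by simp
  also have "\<dots> = Re ((cnj X * cnj (X * (d_z B w + B w * L) + cnj X * d_zbar B w)) * cnj (a w)
      + (- X * (X * (d_z a w + a w * L) + cnj X * d_zbar a w)) * B w)"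
    using N by (simp only: distrib_left) simp
  also have "\<dots> = t * (norm X)\<^sup>2 * Re (a w * cnj (a w) + B w * cnj (B w))
     + Re (X\<^sup>2 * (a w * d_z B w - B w * d_z a w))"
    unfolding a' B' cmod_power2 by (simp add: algebra_simps power2_eq_square)
  finally show ?thesis by (simp add: t_def)
qed

lemma span_scale_singleton:
  assumes c: "c \<noteq> 0"
  shows "vec.span {c *s (F :: complex ^ 'n::finite)} = vec.span {F}"
  unfolding vec.span_singleton
proof (intro equalityI image_subsetI)
  fix k
  show "k *s (c *s F) \<in> range (\<lambda>k. k *s F)" by (intro range_eqI[of _ _ "k * c"]) simp
  show "k *s F \<in> range (\<lambda>k. k *s (c *s F))" using c by (intro image_eqI[of _ _ "k / c"]) simp_all
qed

section \<open>Homogeneous and affine coordinates\<close>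

lemma homogeneous_coords_Abs:
  "F \<noteq> 0 \<Longrightarrow> homogeneous_coords (Abs_cproj (vec.span {F})) F"
  unfolding homogeneous_coords_def by (subst Abs_cproj_inverse) auto

lemma aff_dom_iff:
  assumes "homogeneous_coords L F"
  shows "L \<in> aff_dom k \<longleftrightarrow> F $ k \<noteq> 0"
  using assms by (auto simp: aff_dom_def homogeneous_coords_def vec.span_singleton intro: exI[of _ 1])

lemma aff_chart_eq:
  assumes "homogeneous_coords L F" "F $ k \<noteq> 0"
  shows "aff_chart k L = inverse (F $ k) *s F"
  unfolding aff_chart_def
  using assms by (intro the_equality) (auto simp: homogeneous_coords_def vec.span_singleton field_simps)

section \<open>The map given by a family of eigenspinors\<close>

locale dirac_system =
  fixes M :: "('a::t2_space, 'i) spin_surface"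
    and \<psi> :: "'m::finite \<Rightarrow> ('a, 'i) spinor"
    and lam :: real
  assumes M: "compact_spin_surface M"
    and lam: "lam \<noteq> 0"
    and eigen: "\<And>j. eigenspinor M lam (\<psi> j)"
    and em: "\<And>i V r w X Y. spin_frame M i V r \<Longrightarrow> w \<in> V \<Longrightarrow>
           (\<Sum>j\<in>UNIV. energy_momentum (s0_sqnorm M i) (spin_comp M i r (\<psi> j)) w X Y)
             = 1/2 * lam * surf_metric M i w X Y"
begin

abbreviation U :: "'i \<Rightarrow> complex set" where "U i \<equiv> coord M i ` cdom M i"

abbreviation S :: "'i \<Rightarrow> complex \<Rightarrow> complex ^ ('m \<times> bool)" where
  "S i \<equiv> in_chart M i (spinor_coords \<psi> i)"

lemma in_chart_coord:
  assumes "i \<in> idx M" "p \<in> cdom M i"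
  shows "in_chart M i f (coord M i p) = f p"
proof -
  obtain h where "homeomorphism (cdom M i) (U i) (coord M i) h"
    using M assms(1) by (auto simp: compact_spin_surface_def riemann_surface_def)
  then have "inj_on (coord M i) (cdom M i)" by (intro inj_on_inverseI[of _ h]) (simp add: homeomorphism_def)
  then show ?thesis using assms(2) by (simp add: in_chart_def)
qed

lemma open_U: "i \<in> idx M \<Longrightarrow> open (U i)"
  using M by (auto simp: compact_spin_surface_def riemann_surface_def)

lemma smooth_spinor:
  assumes "i \<in> idx M"
  shows "smooth_on (in_chart M i (fst (\<psi> j) i)) (U i)" "smooth_on (in_chart M i (snd (\<psi> j) i)) (U i)"
  using eigen[of j] assms by (auto simp: eigenspinor_def spinor_field_def)

lemma S_component:
  "S i u $ (j, True) = in_chart M i (fst (\<psi> j) i) u"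
  "S i u $ (j, False) = cnj (in_chart M i (snd (\<psi> j) i) u)"
  by (simp_all add: in_chart_def spinor_coords_def)

lemma smooth_S:
  assumes i: "i \<in> idx M"
  shows "smooth_on (S i) (U i)"
proof -
  have "Ck_on k (\<lambda>u. S i u $ x) (U i)" for k x
  proof (cases x)
    case (Pair j b)
    then show ?thesis
      using smooth_spinor[OF i, of j] Ck_on_bounded_linear[OF bounded_linear_cnj open_U[OF i]]
      by (cases b) (simp_all add: S_component smooth_on_def)
  qed
  then have "Ck_on k (\<lambda>u. \<chi> x. S i u $ x) (U i)" for k
    by (rule Ck_on_vec_lambda[OF open_U[OF i]])
  then show ?thesis by (simp add: smooth_on_def)
qed

lemma quad_nonzero:
  assumes "i \<in> idx M" "u \<in> U i"
  shows "in_chart M i (quad M i) u \<noteq> 0"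
proof -
  obtain p where p: "p \<in> cdom M i" "u = coord M i p" using assms(2) by blast
  have "quad M i p \<noteq> 0"
    using M assms(1) p(1) unfolding compact_spin_surface_def square_is_canonical_def by blast
  then show ?thesis by (simp add: p(2) in_chart_coord[OF assms(1) p(1)])
qed

lemma dens_pos:
  assumes "i \<in> idx M" "u \<in> U i"
  shows "in_chart M i (dens M i) u > 0"
proof -
  obtain p where p: "p \<in> cdom M i" "u = coord M i p" using assms(2) by blast
  have "dens M i p > 0"
    using M assms(1) p(1) unfolding compact_spin_surface_def hermitian_metric_def by blast
  then show ?thesis by (simp add: p(2) in_chart_coord[OF assms(1) p(1)])
qed

text \<open>The hypotheses on the spinors are stated in frames \<open>s_0\<close>, so one is needed
  around each point: a ball is simply connected, hence the nowhere vanishing holomorphic function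
  \<open>quad\<close> has a holomorphic square root there.\<close>

lemma spin_frame_exists:
  assumes i: "i \<in> idx M" and w: "w \<in> U i"
  obtains V r where "spin_frame M i V r" "w \<in> V"
proof -
  obtain e where e: "e > 0" "ball w e \<subseteq> U i"
    using open_U[OF i] w openE by blast
  have "in_chart M i (quad M i) holomorphic_on U i"
    using M i by (simp add: compact_spin_surface_def square_is_canonical_def)
  then have "in_chart M i (quad M i) holomorphic_on ball w e"
    using e(2) by (rule holomorphic_on_subset)
  moreover have "\<forall>z\<in>ball w e. in_chart M i (quad M i) z \<noteq> 0"
    using quad_nonzero[OF i] e(2) by blast
  moreover have "simply_connected (ball w e)"
    by (rule convex_imp_simply_connected[OF convex_ball])
  ultimately obtain r where "r holomorphic_on ball w e" "\<forall>z\<in>ball w e. in_chart M i (quad M i) z = (r z)\<^sup>2"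
    unfolding simply_connected_eq_holomorphic_sqrt[OF open_ball] by blast
  then have "spin_frame M i (ball w e) r"
    using i e by (simp add: spin_frame_def)
  then show thesis using that e(1) by simp
qed

text \<open>The lift with components relative to \<open>s_0\<close> instead of \<open>e_i\<close>.
  The factor \<open>r\<close> leaves the point of projective space unchanged.\<close>

definition F :: "'i \<Rightarrow> (complex \<Rightarrow> complex) \<Rightarrow> complex \<Rightarrow> complex ^ ('m \<times> bool)" where
  "F i r u = r u *s S i u"

definition Fz :: "'i \<Rightarrow> (complex \<Rightarrow> complex) \<Rightarrow> complex \<Rightarrow> complex ^ ('m \<times> bool)" where
  "Fz i r u = (\<chi> x. d_z (\<lambda>w. F i r w $ x) u)"

lemma F_component:
  "F i r u $ (j, True) = fst (spin_comp M i r (\<psi> j) u)"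
  "F i r u $ (j, False) = cnj (snd (spin_comp M i r (\<psi> j) u))"
  by (simp_all add: F_def S_component spin_comp_def)

context
  fixes i V r w
  assumes fr: "spin_frame M i V r" and w: "w \<in> V"
begin

lemma frame_facts: "i \<in> idx M" "open V" "w \<in> U i" "r w \<noteq> 0"
proof -
  show *: "i \<in> idx M" "open V" "w \<in> U i" using fr w by (auto simp: spin_frame_def)
  have "(r w)\<^sup>2 \<noteq> 0" using fr w quad_nonzero[OF *(1,3)] by (simp add: spin_frame_def)
  then show "r w \<noteq> 0" by simp
qed

lemma s0_sqnorm: "s0_sqnorm M i w > 0" "in_chart M i (dens M i) w = 1 / (s0_sqnorm M i w)\<^sup>2"
  using dens_pos[OF frame_facts(1,3)] by (simp_all add: s0_sqnorm_def power_divide)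

lemma spin_comp_differentiable:
  "(\<lambda>u. fst (spin_comp M i r (\<psi> j) u)) differentiable (at w)"
  "(\<lambda>u. snd (spin_comp M i r (\<psi> j) u)) differentiable (at w)"
proof -
  have "r field_differentiable (at w)"
    using fr w by (auto simp: spin_frame_def intro: holomorphic_on_imp_differentiable_at)
  then obtain r' where r: "(r has_derivative r') (at w)"
    unfolding field_differentiable_def has_field_derivative_def by blast
  note sm = smooth_spinor[OF frame_facts(1), THEN smooth_on_imp_differentiable, OF frame_facts(3)]
  obtain p' where p: "(in_chart M i (fst (\<psi> j) i) has_derivative p') (at w)"
    using sm(1) unfolding differentiable_def by blast
  obtain q' where q: "(in_chart M i (snd (\<psi> j) i) has_derivative q') (at w)"
    using sm(2) unfolding differentiable_def by blast
  show "(\<lambda>u. fst (spin_comp M i r (\<psi> j) u)) differentiable (at w)"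
    "(\<lambda>u. snd (spin_comp M i r (\<psi> j) u)) differentiable (at w)"
    unfolding spin_comp_def fst_conv snd_conv differentiable_def
    using has_derivative_mult[OF r p] has_derivative_mult[OF has_derivative_cnj[OF r] q] by blast+
qed

lemma F_differentiable: "(\<lambda>u. F i r u $ x) differentiable (at w)"
proof (cases x)
  case (Pair j b)
  obtain q' where "((\<lambda>u. snd (spin_comp M i r (\<psi> j) u)) has_derivative q') (at w)"
    using spin_comp_differentiable(2) unfolding differentiable_def by blast
  from has_derivative_cnj[OF this]
  have "(\<lambda>u. cnj (snd (spin_comp M i r (\<psi> j) u))) differentiable (at w)"
    unfolding differentiable_def by blast
  then show ?thesis
    using spin_comp_differentiable(1) Pair by (cases b) (simp_all add: F_component)
qed

text \<open>Storing the conjugate of the minus component turns its holomorphic derivative into an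
  antiholomorphic one, so the Dirac equation prescribes the antiholomorphic derivative of every
  component of \<open>F\<close>.\<close>

lemma dirac_equations:
  "d_zbar (\<lambda>u. F i r u $ (j, True)) w = - of_real lam * cnj (F i r w $ (j, False)) / (2 * of_real (s0_sqnorm M i w))"
  "d_zbar (\<lambda>u. F i r u $ (j, False)) w = of_real lam * cnj (F i r w $ (j, True)) / (2 * of_real (s0_sqnorm M i w))"
proof -
  let ?f = "spin_comp M i r (\<psi> j)" and ?N = "s0_sqnorm M i"
  have "dirac ?N ?f w = (of_real lam * fst (?f w), of_real lam * snd (?f w))"
    using eigen[of j] fr w by (auto simp: eigenspinor_def)
  then have d: "2 * of_real (?N w) * d_z (\<lambda>u. snd (?f u)) w = of_real lam * fst (?f w)"
    "- 2 * of_real (?N w) * d_zbar (\<lambda>u. fst (?f u)) w = of_real lam * snd (?f w)"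
    by (simp_all add: dirac_def del_g_def delbar_g_def o_def mult.assoc)
  have N: "2 * complex_of_real (?N w) \<noteq> 0" using s0_sqnorm(1) by simp
  have "d_z (\<lambda>u. snd (?f u)) w = of_real lam * fst (?f w) / (2 * of_real (?N w))"
    using d(1) N by (simp add: field_simps)
  then show "d_zbar (\<lambda>u. F i r u $ (j, False)) w = of_real lam * cnj (F i r w $ (j, True)) / (2 * of_real (?N w))"
    unfolding F_component d_z_cnj[OF spin_comp_differentiable(2)] by simp
  show "d_zbar (\<lambda>u. F i r u $ (j, True)) w = - of_real lam * cnj (F i r w $ (j, False)) / (2 * of_real (?N w))"
    unfolding F_component using arg_cong[OF d(2), of uminus] N by (simp add: field_simps)
qed

text \<open>On the diagonal the hypothesis compares quadratic forms in \<open>X\<close>. The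
  multiples of |X|^2 give the norm of \<open>F\<close>, where \<open>lam\<close> is cancelled; the
  remaining form Re (X^2 K) must vanish.\<close>

lemma energy_momentum_condition:
  "hinner (F i r w) (F i r w) = 1 / of_real (s0_sqnorm M i w)" "hinner (Fz i r w) (quat_J (F i r w)) = 0"
proof -
  let ?N = "s0_sqnorm M i w"
  define n where "n = (norm (F i r w))\<^sup>2"
  define K where "K = hinner (Fz i r w) (quat_J (F i r w))"
  have n: "hinner (F i r w) (F i r w) = of_real n" by (simp add: n_def hinner_self)
  note N = s0_sqnorm
  define a where "a j = fst \<circ> spin_comp M i r (\<psi> j)" for j
  define B where "B j = cnj \<circ> snd \<circ> spin_comp M i r (\<psi> j)" for j
  have F: "F i r u $ (j, True) = a j u" "F i r u $ (j, False) = B j u" for u j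
    by (simp_all add: F_component a_def B_def)
  have F': "(\<lambda>u. F i r u $ (j, True)) = a j" "(\<lambda>u. F i r u $ (j, False)) = B j" for j
    by (simp_all add: fun_eq_iff F)
  have re_sum: "(\<Sum>j\<in>UNIV. b * Re (s j) + Re (z * t j)) = b * Re (\<Sum>j\<in>UNIV. s j) + Re (z * (\<Sum>j\<in>UNIV. t j))"
    for b z and s t :: "'m \<Rightarrow> complex"
    by (simp only: sum.distrib Re_sum sum_distrib_left)
  have Q: "lam / (2 * ?N) * (norm X)\<^sup>2 * n + Re (X\<^sup>2 * K) = 1/2 * lam * (1 / ?N\<^sup>2 * (norm X)\<^sup>2)" for X
  proof -
    have "energy_momentum (s0_sqnorm M i) (spin_comp M i r (\<psi> j)) w X X =
      lam / (2 * ?N) * (norm X)\<^sup>2 * Re (a j w * cnj (a j w) + B j w * cnj (B j w))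
     + Re (X\<^sup>2 * (a j w * d_z (B j) w - B j w * d_z (a j) w))" for j
      unfolding a_def B_def
      by (rule energy_momentum_diagonal, unfold a_def[symmetric] B_def[symmetric])
        (use s0_sqnorm(1) dirac_equations[of j, unfolded F' F] in auto)
    then have "1/2 * lam * surf_metric M i w X X =
      (\<Sum>j\<in>UNIV. lam / (2 * ?N) * (norm X)\<^sup>2 * Re (a j w * cnj (a j w) + B j w * cnj (B j w))
     + Re (X\<^sup>2 * (a j w * d_z (B j) w - B j w * d_z (a j) w)))"
      using em[OF fr w, of X X] by simp
    also have "\<dots> = lam / (2 * ?N) * (norm X)\<^sup>2 * Re (\<Sum>j\<in>UNIV. a j w * cnj (a j w) + B j w * cnj (B j w))
      + Re (X\<^sup>2 * (\<Sum>j\<in>UNIV. a j w * d_z (B j) w - B j w * d_z (a j) w))"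
      by (rule re_sum)
    also have "(\<Sum>j\<in>UNIV. a j w * cnj (a j w) + B j w * cnj (B j w)) = hinner (F i r w) (F i r w)"
      by (simp add: hinner_def sum_UNIV_prod_bool F)
    also have "(\<Sum>j\<in>UNIV. a j w * d_z (B j) w - B j w * d_z (a j) w) = K"
      by (simp add: K_def hinner_def sum_UNIV_prod_bool Fz_def F quat_J_simps algebra_simps)
    finally show ?thesis
      by (simp add: surf_metric_def N(2) n power2_norm_eq_inner)
  qed
  \<comment> \<open>The values 1 and \<open>\<i>\<close> of \<open>X\<close> have squares 1 and -1
    and isolate \<open>Re K\<close>; the square of \<open>1 + \<i>\<close> is
    \<open>2 * \<i>\<close> and isolates \<open>Im K\<close>.\<close>
  have 1: "lam / (2 * ?N) * n + Re K = 1/2 * lam * (1 / ?N\<^sup>2)" using Q[of 1] by simp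
  have 2: "lam / (2 * ?N) * n - Re K = 1/2 * lam * (1 / ?N\<^sup>2)" using Q[of "\<i>"] by simp
  have 3: "lam / (2 * ?N) * 2 * n - 2 * Im K = lam * (1 / ?N\<^sup>2)"
  proof -
    have "(norm (1 + \<i>))\<^sup>2 = 2" "(1 + \<i>)\<^sup>2 = 2 * \<i>"
      by (simp add: cmod_power2) (simp add: power2_eq_square algebra_simps)
    then show ?thesis using Q[of "1 + \<i>"] by simp
  qed
  from 1 2 have "Re K = 0" by linarith
  moreover from 1 2 3 have "Im K = 0" by (simp add: field_simps)
  ultimately show "K = 0" by (simp add: complex_eq_iff)
  from 1 \<open>Re K = 0\<close> have "lam * n / ?N = lam / ?N\<^sup>2" by simp
  then have "n = 1 / ?N" using lam N(1) by (simp add: field_simps power2_eq_square)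
  then show "hinner (F i r w) (F i r w) = 1 / of_real ?N" using n by simp
qed

text \<open>The factor \<open>1 / s0_sqnorm\<close> in the Dirac equation is replaced by |F|^2. This
  removes the metric of the surface and gives the equation required by
  \<open>projective_curve\<close>, with \<open>a = lam / 2\<close>.\<close>

lemma F_has_derivative:
  "(F i r has_derivative (\<lambda>v. v *s Fz i r w
     + cnj v *s ((of_real (lam / 2) * hinner (F i r w) (F i r w)) *s quat_J (F i r w)))) (at w)"
proof -
  have "((\<lambda>u. \<chi> x. F i r u $ x) has_derivative
     (\<lambda>v. \<chi> x. v * d_z (\<lambda>u. F i r u $ x) w + cnj v * d_zbar (\<lambda>u. F i r u $ x) w)) (at w)"
    by (intro has_derivative_vec_lambda has_derivative_wirtinger F_differentiable)
  moreover have "(\<chi> x. v * d_z (\<lambda>u. F i r u $ x) w + cnj v * d_zbar (\<lambda>u. F i r u $ x) w) = v *s Fz i r w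
     + cnj v *s ((of_real (lam / 2) * hinner (F i r w) (F i r w)) *s quat_J (F i r w))" for v
    by (rule vec_prod_bool_eqI)
      (simp_all add: Fz_def dirac_equations quat_J_simps energy_momentum_condition(1))
  ultimately show ?thesis by simp
qed

end

section \<open>The global map into projective space\<close>

lemma S_nonzero:
  assumes "i \<in> idx M" "w \<in> U i"
  shows "S i w \<noteq> 0"
proof -
  obtain V r where fr: "spin_frame M i V r" "w \<in> V" using spin_frame_exists[OF assms] .
  then have "F i r w \<noteq> 0"
    using energy_momentum_condition(1)[OF fr] s0_sqnorm(1)[OF fr] hinner_self_eq_0_iff[of "F i r w"] by simp
  then show ?thesis by (auto simp: F_def)
qed

definition chart_at :: "'a \<Rightarrow> 'i" where "chart_at p = (SOME i. i \<in> idx M \<and> p \<in> cdom M i)"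

lemma chart_at: "chart_at p \<in> idx M" "p \<in> cdom M (chart_at p)"
proof -
  have "\<exists>i. i \<in> idx M \<and> p \<in> cdom M i"
    using M unfolding compact_spin_surface_def riemann_surface_def by blast
  from someI_ex[OF this] show "chart_at p \<in> idx M" "p \<in> cdom M (chart_at p)"
    by (simp_all add: chart_at_def)
qed

definition Psi :: "'a \<Rightarrow> ('m \<times> bool) cproj" where
  "Psi p = Abs_cproj (vec.span {spinor_coords \<psi> (chart_at p) p})"

lemma spinor_coords_nonzero:
  assumes "i \<in> idx M" "p \<in> cdom M i"
  shows "spinor_coords \<psi> i p \<noteq> 0"
  using S_nonzero[of i "coord M i p"] assms by (simp add: in_chart_coord)

text \<open>\<open>Psi\<close> is defined through an arbitrarily chosen chart. The choice is
  immaterial: plus components change by the cocycle and minus components by its conjugate, so after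
  conjugating the latter the whole vector is scaled by one nonzero factor.\<close>

lemma homogeneous_coords_Psi:
  assumes i: "i \<in> idx M" and p: "p \<in> cdom M i"
  shows "homogeneous_coords (Psi p) (spinor_coords \<psi> i p)"
proof -
  let ?j = "chart_at p"
  let ?c = "cocycle M i ?j p"
  have c: "?c \<noteq> 0"
    using M i p chart_at[of p] unfolding compact_spin_surface_def holomorphic_line_bundle_def by blast
  have "fst (\<psi> k) i p = ?c * fst (\<psi> k) ?j p" "snd (\<psi> k) i p = cnj ?c * snd (\<psi> k) ?j p" for k
  proof -
    have "spinor_field M (\<psi> k)" using eigen[of k] by (simp add: eigenspinor_def)
    then show "fst (\<psi> k) i p = ?c * fst (\<psi> k) ?j p" "snd (\<psi> k) i p = cnj ?c * snd (\<psi> k) ?j p"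
      using i p chart_at[of p] unfolding spinor_field_def by blast+
  qed
  then have "spinor_coords \<psi> i p = ?c *s spinor_coords \<psi> ?j p"
    by (intro vec_prod_bool_eqI) (simp_all add: spinor_coords_def)
  then have "vec.span {spinor_coords \<psi> i p} = vec.span {spinor_coords \<psi> ?j p}"
    by (simp add: span_scale_singleton[OF c])
  then show ?thesis
    using homogeneous_coords_Abs[OF spinor_coords_nonzero[OF chart_at]] spinor_coords_nonzero[OF i p]
    by (simp add: Psi_def homogeneous_coords_def)
qed

lemma chart_dom_Psi:
  assumes i: "i \<in> idx M"
  shows "chart_dom M Psi i k = {w \<in> U i. S i w $ k \<noteq> 0}"
proof -
  have "Psi p \<in> aff_dom k \<longleftrightarrow> spinor_coords \<psi> i p $ k \<noteq> 0" if "p \<in> cdom M i" for p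
    by (rule aff_dom_iff[OF homogeneous_coords_Psi[OF i that]])
  then show ?thesis by (auto simp: chart_dom_def in_chart_coord[OF i] intro!: imageI)
qed

lemma chart_map_Psi:
  assumes i: "i \<in> idx M" and w: "w \<in> chart_dom M Psi i k"
  shows "chart_map M Psi i k w = inverse (S i w $ k) *s S i w"
proof -
  obtain p where p: "p \<in> cdom M i" "w = coord M i p" using w by (auto simp: chart_dom_def)
  have "spinor_coords \<psi> i p $ k \<noteq> 0"
    using w by (simp add: chart_dom_Psi[OF i] p(2) in_chart_coord[OF i p(1)])
  from aff_chart_eq[OF homogeneous_coords_Psi[OF i p(1)] this] show ?thesis
    by (simp add: chart_map_def p in_chart_coord[OF i p(1)])
qed

lemma open_chart_dom_Psi:
  assumes i: "i \<in> idx M"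
  shows "open (chart_dom M Psi i k)"
proof -
  have "continuous_on (U i) (\<lambda>w. S i w $ k)"
    using smooth_on_imp_continuous_on[OF smooth_S[OF i]] by (intro continuous_intros)
  from continuous_open_preimage[OF this open_U[OF i] open_Compl[OF closed_singleton]]
  have "open (U i \<inter> (\<lambda>w. S i w $ k) -` (- {0}))" .
  also have "U i \<inter> (\<lambda>w. S i w $ k) -` (- {0}) = {w \<in> U i. S i w $ k \<noteq> 0}" by auto
  finally show ?thesis unfolding chart_dom_Psi[OF i] .
qed

lemma smooth_chart_map_Psi:
  assumes i: "i \<in> idx M"
  shows "smooth_on (chart_map M Psi i k) (chart_dom M Psi i k)"
proof -
  let ?D = "chart_dom M Psi i k"
  have sub: "?D \<subseteq> U i" by (auto simp: chart_dom_Psi[OF i])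
  have "Ck_on n (\<lambda>w. inverse (S i w $ k) *s S i w) ?D" for n
  proof -
    have 1: "Ck_on n (S i) ?D" using smooth_S[OF i] by (auto simp: smooth_on_def intro: Ck_on_subset[OF sub])
    then have "Ck_on n (\<lambda>w. inverse (S i w $ k)) ?D"
      by (intro Ck_on_inverse Ck_on_bounded_linear[OF bounded_linear_component] open_chart_dom_Psi[OF i])
        (auto simp: chart_dom_Psi[OF i])
    then show ?thesis
      by (rule Ck_on_bounded_bilinear[OF bounded_bilinear_vector_scalar_mult open_chart_dom_Psi[OF i] _ 1])
  qed
  then show ?thesis
    by (intro smooth_on_cong[OF open_chart_dom_Psi[OF i] chart_map_Psi[OF i, symmetric]]) (auto simp: smooth_on_def)
qed

lemma branched_minimal_immersion_Psi:
  assumes c: "c > 0"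
  shows "branched_minimal_immersion c M Psi"
proof -
  let ?h = "\<lambda>F X Y. c * fubini_study F X Y"
  \<comment> \<open>The first alternative in \<open>branched_minimal_immersion\<close> is shown at
    every point.\<close>
  have "conformal_immersion_at (surf_metric M i) ?h (chart_map M Psi i k) w \<and>
        minimal_at (aff_dir k) ?h (chart_map M Psi i k) w"
    if i: "i \<in> idx M" and w: "w \<in> chart_dom M Psi i k" for i k w
  proof -
    let ?D = "chart_dom M Psi i k"
    have "w \<in> U i" using w by (auto simp: chart_dom_Psi[OF i])
    then obtain V r where fr: "spin_frame M i V r" "w \<in> V" using spin_frame_exists[OF i] by blast
    \<comment> \<open>On \<open>V \<inter> ?D\<close> both the frame \<open>s_0\<close> and the
      affine chart \<open>k\<close> are available.\<close>
    interpret projective_curve quat_J "F i r" "chart_map M Psi i k" "Fz i r" "V \<inter> ?D" k "lam / 2"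
    proof (rule projective_curve.intro)
      show "open (V \<inter> ?D)" using frame_facts(2)[OF fr] open_chart_dom_Psi[OF i] by blast
      show "smooth_on (chart_map M Psi i k) (V \<inter> ?D)"
        by (rule smooth_on_subset[OF _ smooth_chart_map_Psi[OF i]]) blast
      fix u assume u: "u \<in> V \<inter> ?D"
      then have fru: "spin_frame M i V r" "u \<in> V" using fr(1) by auto
      have "S i u $ k \<noteq> 0" using u by (simp add: chart_dom_Psi[OF i])
      then show "F i r u = F i r u $ k *s chart_map M Psi i k u" "F i r u $ k \<noteq> 0"
        using u frame_facts(4)[OF fru] by (simp_all add: F_def chart_map_Psi[OF i])
      show "(F i r has_derivative (\<lambda>v. v *s Fz i r u
         + cnj v *s ((of_real (lam / 2) * hinner (F i r u) (F i r u)) *s quat_J (F i r u)))) (at u)"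
        by (rule F_has_derivative[OF fru])
      show "hinner (Fz i r u) (quat_J (F i r u)) = 0"
        by (rule energy_momentum_condition(2)[OF fru])
    qed (use lam quat_J in auto)
    have w': "w \<in> V \<inter> ?D" using w fr by blast
    show ?thesis
      using conformal_immersion[OF w' c dens_pos[OF i \<open>w \<in> U i\<close>]] minimal[OF w' c]
      by (simp add: surf_metric_def)
  qed
  then show ?thesis
    using open_chart_dom_Psi smooth_chart_map_Psi
    by (simp add: branched_minimal_immersion_def smooth_map_def Let_def)
qed

end

theorem theorem4p9:
  fixes M :: "('a::t2_space, 'i) spin_surface"
    and \<psi> :: "'m::finite \<Rightarrow> ('a, 'i) spinor"
    and lam c :: real
  assumes "compact_spin_surface M"
    and "lam \<noteq> 0"
    and "\<And>j. eigenspinor M lam (\<psi> j)"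
    and "\<And>i V r w X Y. spin_frame M i V r \<Longrightarrow> w \<in> V \<Longrightarrow>
           (\<Sum>j\<in>UNIV. energy_momentum (s0_sqnorm M i) (spin_comp M i r (\<psi> j)) w X Y)
             = 1/2 * lam * surf_metric M i w X Y"
    and "c > 0"
  shows "\<exists>\<Psi> :: 'a \<Rightarrow> ('m \<times> bool) cproj.
           (\<forall>i\<in>idx M. \<forall>p\<in>cdom M i. homogeneous_coords (\<Psi> p) (spinor_coords \<psi> i p)) \<and>
           branched_minimal_immersion c M \<Psi>"
proof -
  interpret dirac_system M \<psi> lam
    using assms(1-4) by unfold_locales
  show ?thesis
    using homogeneous_coords_Psi branched_minimal_immersion_Psi[OF assms(5)] by blast
qed

end
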